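(* Consider the algorithm GenQSGD described in the context. Suppose that: (1) (random quantization) for every $s\in\mathbb Z_+$ there is a constant $q_s>0$ such that for all $\mathbf y\in\mathbb R^D$: $\mathbb E[\mathbf Q(\mathbf y;s)]=\mathbf y$ and $\mathbb E[\|\mathbf Q(\mathbf y;s)-\mathbf y\|_2^2]\le q_s\|\mathbf y\|_2^2$; (2) $\zeta_1,\dots,\zeta_N$ are i.i.d.; (3) (smoothness) there is $L>0$ such that for all $n\in\mathcal N$, $f_n$ is continuously differentiable and $\|\nabla f_n(\mathbf x)-\nabla f_n(\mathbf y)\|_2\le L\|\mathbf x-\mathbf y\|_2$ for all $\mathbf x,\mathbf y\in\mathbb R^D$; (4) (bounded variances) there is $\sigma>0$ such that $\mathbb E[\|\nabla F(\mathbf x;\zeta_n)-\nabla f_n(\mathbf x)\|_2^2]\le\sigma^2$ for all $n\in\mathcal N$, $\mathbf x\in\mathbb R^D$; (5) (bounded second moments) there is $G>0$ such that $\mathbb E[\|\nabla F(\mathbf x;\zeta_n)\|_2^2]\le G^2$ for all $n\in\mathcal N$, $\mathbf x\in\mathbb R^D$; (6) the step sizes satisfy $\gamma^{(k_0)}\in(0,\frac1L]$ for all $k_0\in\mathcal K_0$. Then, for all $\mathbf K\in\mathbb Z_+^{N+1}$ and $B\in\mathbb Z_+$, the sequence $\{\bar{\mathbf x}^{(k_0,k)}\}$ generated by GenQSGD satisfies $$\frac{\sum_{k_0\in\mathcal K_0}\gamma^{(k_0)}\sum_{k\in\mathcal K_{\max}}\frac{N_k}{N}\mathbb E\left[\left\|\nabla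 f\left(\bar{\mathbf x}^{(k_0,k-1)}\right)\right\|_2^2\right]}{\sum_{k_0\in\mathcal K_0}\gamma^{(k_0)}\sum_{k\in\mathcal K_{\max}}\frac{N_k}{N}}\le C_A(\mathbf K,B,\mathbf\Gamma),$$ where $$C_A(\mathbf K,B,\mathbf\Gamma)=\frac{c_1}{\sum_{n\in\mathcal N}K_n\sum_{k_0\in\mathcal K_0}\gamma^{(k_0)}}+\frac{c_2\max_{n\in\mathcal N}K_n^2\sum_{k_0\in\mathcal K_0}(\gamma^{(k_0)})^3}{\sum_{k_0\in\mathcal K_0}\gamma^{(k_0)}}+\frac{c_3\sum_{k_0\in\mathcal K_0}(\gamma^{(k_0)})^2}{B\sum_{k_0\in\mathcal K_0}\gamma^{(k_0)}}+\frac{c_4\sum_{n\in\mathcal N}q_{s_0,s_n}K_n^2\sum_{k_0\in\mathcal K_0}(\gamma^{(k_0)})^2}{\sum_{n\in\mathcal N}K_n\sum_{k_0\in\mathcal K_0}\gamma^{(k_0)}},$$ with $q_{s_0,s_n}=q_{s_0}+q_{s_n}+q_{s_0}q_{s_n}$, $c_1=2N(f(\hat{\mathbf x}^{(1)})-f^* )$, $c_2=4G^2L^2$, $c_3=\frac{L\sigma^2}{N}$, $c_4=2LG^2$.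
   Context: Problem. $N,D\in\mathbb Z_+$ (positive integers), $\mathcal N=\{1,\dots,N\}$. Worker $n\in\mathcal N$ has data distributed as a random variable $\zeta_n$; $F(\mathbf x;\zeta)$ is the loss of model $\mathbf x\in\mathbb R^D$ on sample $\zeta$; $f_n(\mathbf x)=\mathbb E[F(\mathbf x;\zeta_n)]$, $f(\mathbf x)=\frac1N\sum_{n\in\mathcal N}f_n(\mathbf x)$ (not necessarily convex), $f^*=\min_{\mathbf x}f(\mathbf x)$. $\nabla F$ is the gradient in $\mathbf x$, and $\mathbb E[\nabla F(\mathbf x;\zeta_n)]=\nabla f_n(\mathbf x)$. Quantizer. $\mathbf Q(\cdot;s):\mathbb R^D\to\mathbb R^D$ is a random map with parameter $s\in\mathbb Z_+$; the server uses $s_0\in\mathbb Z_+$ and worker $n$ uses $s_n\in\mathbb Z_+$. Parameters. $\mathbf K=(K_0,K_1,\dots,K_N)\in\mathbb Z_+^{N+1}$ ($K_0$ global iterations, $K_n$ local iterations at worker $n$), mini-batch size $B\in\mathbb Z_+$, step sizes $\mathbf\Gamma=(\gamma^{(1)},\dots,\gamma^{(K_0)})$; $\mathcal K_0=\{1,\dots,K_0\}$, $\mathcal K_n=\{1,\dots,K_n\}$, $\mathcal K_{\max}=\{1,\dots,\max_{n\in\mathcal N}K_n\}$. GenQSGD. Start from a given common global model $\hat{\mathbf x}^{(1)}\in\mathbb R^D$. For $k_0=1,\dots,K_0$: each worker $n$ sets $\mathbf x_n^{(k_0,0)}=\hat{\mathbf x}^{(k_0)}$ and, for $k_n=1,\dots,K_n$,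 draws a random mini-batch $\mathcal B_n^{(k_0,k_n)}$ of $B$ samples and sets $$\mathbf x_n^{(k_0,k_n)}=\mathbf x_n^{(k_0,k_n-1)}-\frac{\gamma^{(k_0)}}{B}\sum_{\xi\in\mathcal B_n^{(k_0,k_n)}}\nabla F(\mathbf x_n^{(k_0,k_n-1)};\xi);$$ then the server forms $\Delta\hat{\mathbf x}^{(k_0)}=\frac1N\sum_{n\in\mathcal N}\mathbf Q\big(\frac{\mathbf x_n^{(k_0,K_n)}-\hat{\mathbf x}^{(k_0)}}{\gamma^{(k_0)}};s_n\big)$ and the next global model is $\hat{\mathbf x}^{(k_0+1)}=\hat{\mathbf x}^{(k_0)}+\gamma^{(k_0)}\mathbf Q(\Delta\hat{\mathbf x}^{(k_0)};s_0)$. Randomness. The mini-batch samples of worker $n$ are independent copies of $\zeta_n$, independent across samples, workers and iterations; the randomness of each quantizer call is independent of everything previously generated and of the other calls. Expectations are over this randomness with $\hat{\mathbf x}^{(1)}$ given. Notation. $\tilde{\mathbf x}_n^{(k_0,k)}=\mathbf x_n^{(k_0,k)}$ if $k\in\mathcal K_n$ and $\tilde{\mathbf x}_n^{(k_0,k)}=\mathbf x_n^{(k_0,K_n)}$ if $k\in\mathcal K_{\max}\setminus\mathcal K_n$; $\bar{\mathbf x}^{(k_0,k)}=\frac1N\sum_{n\in\mathcal N}\tilde{\mathbf x}_n^{(k_0,k)}$ for $k\in\mathcal K_{\max}$, and $\bar{\mathbf x}^{(k_0,0)}=\hat{\mathbf x}^{(k_0)}$; $N_k=\sum_{n\in\mathcal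 N}\mathbb I[k\le K_n]$ is the number of workers with $K_n\ge k$. *)

theory Defs
  imports "HOL-Probability.Probability"
begin

definition grad :: "('a::real_inner \<Rightarrow> real) \<Rightarrow> 'a \<Rightarrow> 'a" where
  "grad f x = (THE D. GDERIV f x :> D)"

lemma GDERIV_unique:
  fixes f :: "'a::real_inner \<Rightarrow> real"
  assumes "GDERIV f x :> D" "GDERIV f x :> E"
  shows "D = E"
proof -
  have "(\<lambda>h. inner h D) = (\<lambda>h. inner h E)"
    using assms has_derivative_unique unfolding gderiv_def by blast
  then have "inner (D - E) D = inner (D - E) E" by meson
  then have "inner (D - E) (D - E) = 0" by (simp only: inner_diff_right)
  then show ?thesis by simp
qed

lemma grad_eqI: "GDERIV f x :> D \<Longrightarrow> grad f x = D"
  unfolding grad_def using GDERIV_unique by blast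

lemma differentiable_imp_GDERIV_grad:
  fixes f :: "'a::euclidean_space \<Rightarrow> real"
  assumes "f differentiable (at x)"
  shows "GDERIV f x :> grad f x"
proof -
  obtain f' where f': "FDERIV f x :> f'"
    using assms unfolding differentiable_def by blast
  then have lin: "bounded_linear f'" by (rule has_derivative_bounded_linear)
  define D where "D = (\<Sum>b\<in>Basis. f' b *\<^sub>R b)"
  have "f' h = inner h D" for h
  proof -
    have "f' h = f' (\<Sum>b\<in>Basis. inner h b *\<^sub>R b)"
      by (simp add: euclidean_representation)
    also have "\<dots> = (\<Sum>b\<in>Basis. inner h b * f' b)"
      using lin by (simp add: linear_sum[OF bounded_linear.linear] linear_cmul[OF bounded_linear.linear])
    also have "\<dots> = inner h D"
      by (simp add: D_def inner_sum_right mult.commute)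
    finally show ?thesis .
  qed
  then have "f' = (\<lambda>h. inner h D)" by blast
  with f' have "GDERIV f x :> D" by (simp add: gderiv_def)
  then show ?thesis using grad_eqI by metis
qed

definition local_loss ::
    "'w measure \<Rightarrow> ('a \<Rightarrow> 'z \<Rightarrow> real) \<Rightarrow> (nat \<Rightarrow> 'w \<Rightarrow> 'z) \<Rightarrow> nat \<Rightarrow> 'a \<Rightarrow> real" where
  "local_loss M F \<zeta> n x = (\<integral>\<omega>. F x (\<zeta> n \<omega>) \<partial>M)"

definition global_loss ::
    "'w measure \<Rightarrow> ('a \<Rightarrow> 'z \<Rightarrow> real) \<Rightarrow> (nat \<Rightarrow> 'w \<Rightarrow> 'z) \<Rightarrow> nat \<Rightarrow> 'a \<Rightarrow> real" where
  "global_loss M F \<zeta> N x = (1 / real N) * (\<Sum>n=1..N. local_loss M F \<zeta> n x)"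

text \<open>
  GenQSGD is defined along one realisation of the randomness:
  \<open>\<xi> n k0 k b\<close> is the \<open>b\<close>-th sample of the mini-batch drawn by worker \<open>n\<close> in local iteration
  \<open>k\<close> of global iteration \<open>k0\<close>. The random map \<open>y \<mapsto> Q(y; t)\<close> is \<open>\<lambda>y. Q t u y\<close> with a random
  seed \<open>u\<close>; \<open>\<theta> k0 n\<close> is the seed of the quantizer call made in global iteration \<open>k0\<close> by worker
  \<open>n\<close>, or by the server if \<open>n = 0\<close>. Likewise \<open>K 0\<close> and \<open>s 0\<close> belong to the server.
  Workers and iterations are numbered from 1.
\<close>

primrec local_model ::
    "('a::real_inner \<Rightarrow> 'z \<Rightarrow> real) \<Rightarrow> nat \<Rightarrow> real \<Rightarrow> (nat \<Rightarrow> nat \<Rightarrow> 'z) \<Rightarrow> 'a \<Rightarrow> nat \<Rightarrow> 'a" where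
  "local_model F B g batch x 0 = x"
| "local_model F B g batch x (Suc k) =
     local_model F B g batch x k
     - (g / real B) *\<^sub>R
         (\<Sum>b=1..B. grad (\<lambda>y. F y (batch (Suc k) b)) (local_model F B g batch x k))"

definition server_update ::
    "('a::real_inner \<Rightarrow> 'z \<Rightarrow> real) \<Rightarrow> (nat \<Rightarrow> 'u \<Rightarrow> 'a \<Rightarrow> 'a) \<Rightarrow> nat \<Rightarrow> (nat \<Rightarrow> nat) \<Rightarrow> nat
      \<Rightarrow> (nat \<Rightarrow> nat) \<Rightarrow> real \<Rightarrow> (nat \<Rightarrow> nat \<Rightarrow> nat \<Rightarrow> 'z) \<Rightarrow> (nat \<Rightarrow> 'u) \<Rightarrow> 'a \<Rightarrow> 'a" where
  "server_update F Q N K B s g batches seeds x =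
     (let \<Delta> = (1 / real N) *\<^sub>R
            (\<Sum>n=1..N. Q (s n) (seeds n)
               ((1 / g) *\<^sub>R (local_model F B g (batches n) x (K n) - x)))
      in x + g *\<^sub>R Q (s 0) (seeds 0) \<Delta>)"

text \<open>The initial model has index 1; the value at index 0 is a dummy.\<close>

primrec global_model ::
    "('a::real_inner \<Rightarrow> 'z \<Rightarrow> real) \<Rightarrow> (nat \<Rightarrow> 'u \<Rightarrow> 'a \<Rightarrow> 'a) \<Rightarrow> nat \<Rightarrow> (nat \<Rightarrow> nat) \<Rightarrow> nat
      \<Rightarrow> (nat \<Rightarrow> nat) \<Rightarrow> (nat \<Rightarrow> real) \<Rightarrow> 'a \<Rightarrow> (nat \<Rightarrow> nat \<Rightarrow> nat \<Rightarrow> nat \<Rightarrow> 'z)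
      \<Rightarrow> (nat \<Rightarrow> nat \<Rightarrow> 'u) \<Rightarrow> nat \<Rightarrow> 'a" where
  "global_model F Q N K B s \<gamma> x1 \<xi> \<theta> 0 = x1"
| "global_model F Q N K B s \<gamma> x1 \<xi> \<theta> (Suc k0) =
     (if k0 = 0 then x1
      else server_update F Q N K B s (\<gamma> k0) (\<lambda>n. \<xi> n k0) (\<theta> k0)
             (global_model F Q N K B s \<gamma> x1 \<xi> \<theta> k0))"

definition worker_model ::
    "('a::real_inner \<Rightarrow> 'z \<Rightarrow> real) \<Rightarrow> (nat \<Rightarrow> 'u \<Rightarrow> 'a \<Rightarrow> 'a) \<Rightarrow> nat \<Rightarrow> (nat \<Rightarrow> nat) \<Rightarrow> nat
      \<Rightarrow> (nat \<Rightarrow> nat) \<Rightarrow> (nat \<Rightarrow> real) \<Rightarrow> 'a \<Rightarrow> (nat \<Rightarrow> nat \<Rightarrow> nat \<Rightarrow> nat \<Rightarrow> 'z)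
      \<Rightarrow> (nat \<Rightarrow> nat \<Rightarrow> 'u) \<Rightarrow> nat \<Rightarrow> nat \<Rightarrow> nat \<Rightarrow> 'a" where
  "worker_model F Q N K B s \<gamma> x1 \<xi> \<theta> n k0 k =
     local_model F B (\<gamma> k0) (\<xi> n k0) (global_model F Q N K B s \<gamma> x1 \<xi> \<theta> k0) k"

definition padded_worker_model ::
    "('a::real_inner \<Rightarrow> 'z \<Rightarrow> real) \<Rightarrow> (nat \<Rightarrow> 'u \<Rightarrow> 'a \<Rightarrow> 'a) \<Rightarrow> nat \<Rightarrow> (nat \<Rightarrow> nat) \<Rightarrow> nat
      \<Rightarrow> (nat \<Rightarrow> nat) \<Rightarrow> (nat \<Rightarrow> real) \<Rightarrow> 'a \<Rightarrow> (nat \<Rightarrow> nat \<Rightarrow> nat \<Rightarrow> nat \<Rightarrow> 'z)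
      \<Rightarrow> (nat \<Rightarrow> nat \<Rightarrow> 'u) \<Rightarrow> nat \<Rightarrow> nat \<Rightarrow> nat \<Rightarrow> 'a" where
  "padded_worker_model F Q N K B s \<gamma> x1 \<xi> \<theta> n k0 k =
     (if k \<le> K n then worker_model F Q N K B s \<gamma> x1 \<xi> \<theta> n k0 k
      else worker_model F Q N K B s \<gamma> x1 \<xi> \<theta> n k0 (K n))"

definition mean_model ::
    "('a::real_inner \<Rightarrow> 'z \<Rightarrow> real) \<Rightarrow> (nat \<Rightarrow> 'u \<Rightarrow> 'a \<Rightarrow> 'a) \<Rightarrow> nat \<Rightarrow> (nat \<Rightarrow> nat) \<Rightarrow> nat
      \<Rightarrow> (nat \<Rightarrow> nat) \<Rightarrow> (nat \<Rightarrow> real) \<Rightarrow> 'a \<Rightarrow> (nat \<Rightarrow> nat \<Rightarrow> nat \<Rightarrow> nat \<Rightarrow> 'z)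
      \<Rightarrow> (nat \<Rightarrow> nat \<Rightarrow> 'u) \<Rightarrow> nat \<Rightarrow> nat \<Rightarrow> 'a" where
  "mean_model F Q N K B s \<gamma> x1 \<xi> \<theta> k0 k =
     (if k = 0 then global_model F Q N K B s \<gamma> x1 \<xi> \<theta> k0
      else (1 / real N) *\<^sub>R
             (\<Sum>n=1..N. padded_worker_model F Q N K B s \<gamma> x1 \<xi> \<theta> n k0 k))"

definition Kmax :: "nat \<Rightarrow> (nat \<Rightarrow> nat) \<Rightarrow> nat" where
  "Kmax N K = Max (K ` {1..N})"

definition active_workers :: "nat \<Rightarrow> (nat \<Rightarrow> nat) \<Rightarrow> nat \<Rightarrow> nat" where
  "active_workers N K k = (\<Sum>n=1..N. of_bool (k \<le> K n))"

text \<open>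
  The elementary random draws. Samples and seeds have different types, so their joint
  independence is expressed through the generated events, as in the definition of
  \<open>indep_vars\<close>.
\<close>

datatype draw = Sample nat nat nat nat | Seed nat nat

definition draws :: "nat \<Rightarrow> (nat \<Rightarrow> nat) \<Rightarrow> nat \<Rightarrow> draw set" where
  "draws N K B =
     {Sample n k0 k b | n k0 k b. n \<in> {1..N} \<and> k0 \<in> {1..K 0} \<and> k \<in> {1..K n} \<and> b \<in> {1..B}}
     \<union> {Seed k0 n | k0 n. k0 \<in> {1..K 0} \<and> n \<in> {0..N}}"

primrec draw_events ::
    "'w measure \<Rightarrow> 'z measure \<Rightarrow> (nat \<Rightarrow> 'u measure) \<Rightarrow> (nat \<Rightarrow> nat)
      \<Rightarrow> (nat \<Rightarrow> nat \<Rightarrow> nat \<Rightarrow> nat \<Rightarrow> 'w \<Rightarrow> 'z) \<Rightarrow> (nat \<Rightarrow> nat \<Rightarrow> 'w \<Rightarrow> 'u) \<Rightarrow> draw \<Rightarrow> 'w set set" where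
  "draw_events M Z U s \<xi> \<theta> (Sample n k0 k b) = {\<xi> n k0 k b -` A \<inter> space M | A. A \<in> sets Z}"
| "draw_events M Z U s \<xi> \<theta> (Seed k0 n) = {\<theta> k0 n -` A \<inter> space M | A. A \<in> sets (U (s n))}"

definition C_A ::
    "nat \<Rightarrow> (nat \<Rightarrow> nat) \<Rightarrow> nat \<Rightarrow> (nat \<Rightarrow> real) \<Rightarrow> (nat \<Rightarrow> nat) \<Rightarrow> (nat \<Rightarrow> real)
      \<Rightarrow> real \<Rightarrow> real \<Rightarrow> real \<Rightarrow> real \<Rightarrow> real \<Rightarrow> real" where
  "C_A N K B \<gamma> s q L \<sigma> G f1 fstar =
     (let c1 = 2 * real N * (f1 - fstar);
          c2 = 4 * G\<^sup>2 * L\<^sup>2;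
          c3 = L * \<sigma>\<^sup>2 / real N;
          c4 = 2 * L * G\<^sup>2;
          qq = (\<lambda>n. q (s 0) + q (s n) + q (s 0) * q (s n));
          sumK = (\<Sum>n=1..N. real (K n));
          sum\<gamma> = (\<Sum>k0=1..K 0. \<gamma> k0)
      in c1 / (sumK * sum\<gamma>)
         + c2 * real (Max ((\<lambda>n. (K n)\<^sup>2) ` {1..N})) * (\<Sum>k0=1..K 0. \<gamma> k0 ^ 3) / sum\<gamma>
         + c3 * (\<Sum>k0=1..K 0. (\<gamma> k0)\<^sup>2) / (real B * sum\<gamma>)
         + c4 * (\<Sum>n=1..N. qq n * (real (K n))\<^sup>2) * (\<Sum>k0=1..K 0. (\<gamma> k0)\<^sup>2) / (sumK * sum\<gamma>))"

end

(*
  Within a round, the mean of the padded local models moves by -\<gamma>/N times the sum of the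
  gradients at the active local models plus a noise term that is centred given the past. The quadratic
  bound for an L-smooth function, the polarisation identity and L\<gamma> \<le> 1 turn this into a
  decrease of f by (\<gamma>/2)(N_k/N) E|\<nabla>f|^2, up to the drift of the local models from their mean, which
  is at most (2\<gamma> K_max G)^2 in mean square, and the variance of the noise, where independence across
  workers and samples gains the factor 1/(N B). Quantization moves the mean model by a centred
  error, so it only adds a second-order term. Summing over local steps and rounds telescopes.

  Conditional expectations are replaced by product measures: a draw that is not among the draws of
  the past is jointly distributed with any quantity measurable with respect to the past as a product.
*)
theory Submission
  imports Defs
begin

text \<open>Identical distribution is what makes unequal numbers of local steps harmless: once all
  local losses coincide, the workers still active contribute gradients of the very function in the
  claim, and only the drift separates their average from the weight N_k/N times the gradient at the
  mean model. Two obstacles shape the formal part. First, the hypotheses on gradients and quantizers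
  concern a fixed point, whereas the models are random; passing from one to the other requires joint
  measurability of the gradient in model and sample, and a draw that is independent of the model.
  The past is indexed by an arbitrary set of draws rather than by time, because two samples of one
  local iteration, or the server seed against the worker seeds, need sigma-algebras lying strictly
  between two time steps. Second, linearity of the integral requires every term to be integrable, so
  square integrability is carried together with adaptedness through all iterations; the lower bound
  \<open>fstar\<close> and the quadratic upper bound then make the loss of every model
  integrable.\<close>

subsection \<open>Smooth functions and joint measurability of gradients\<close>

text \<open>Along the segment from x to y, subtracting the claimed bound from \<open>f\<close>
  leaves a function \<open>\<phi>\<close> of one real variable whose derivative is nonpositive by
  Cauchy-Schwarz and the Lipschitz condition. Monotonicity of \<open>\<phi>\<close> replaces
  integrating the gradient along the segment.\<close>

lemma GDERIV_Lipschitz_upper_bound: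
  fixes f :: "'a::real_inner \<Rightarrow> real"
  assumes grad: "\<And>x. GDERIV f x :> g x"
    and Lipschitz: "\<And>x y. norm (g x - g y) \<le> L * norm (x - y)"
  shows "f y \<le> f x + inner (g x) (y - x) + L / 2 * (norm (y - x))\<^sup>2"
proof -
  define d where "d = y - x"
  define \<phi> where "\<phi> = (\<lambda>t. f (x + t *\<^sub>R d) - t * inner (g x) d - L / 2 * t\<^sup>2 * (norm d)\<^sup>2)"
  have deriv: "(\<phi> has_real_derivative
      (inner d (g (x + t *\<^sub>R d)) - inner (g x) d - L * t * (norm d)\<^sup>2)) (at t)" for t
  proof -
    have "((\<lambda>t. x + t *\<^sub>R d) has_derivative (\<lambda>h. h *\<^sub>R d)) (at t)"
      by (auto intro!: derivative_eq_intros)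
    then have "((\<lambda>t. f (x + t *\<^sub>R d)) has_derivative (\<lambda>h. inner (h *\<^sub>R d) (g (x + t *\<^sub>R d)))) (at t)"
      using grad[of "x + t *\<^sub>R d"] unfolding gderiv_def by (rule has_derivative_compose)
    then have "((\<lambda>t. f (x + t *\<^sub>R d)) has_real_derivative inner d (g (x + t *\<^sub>R d))) (at t)"
      by (simp add: has_field_derivative_def mult.commute[of _ "inner d _"])
    then show ?thesis
      unfolding \<phi>_def by (auto intro!: derivative_eq_intros)
  qed
  have nonpos: "inner d (g (x + t *\<^sub>R d)) - inner (g x) d - L * t * (norm d)\<^sup>2 \<le> 0"
    if "0 \<le> t" for t
  proof -
    have "inner d (g (x + t *\<^sub>R d)) - inner (g x) d = inner d (g (x + t *\<^sub>R d) - g x)"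
      by (simp add: inner_diff_right inner_commute)
    also have "\<dots> \<le> norm d * norm (g (x + t *\<^sub>R d) - g x)"
      by (rule norm_cauchy_schwarz)
    also have "\<dots> \<le> norm d * (L * norm (t *\<^sub>R d))"
      using Lipschitz[of "x + t *\<^sub>R d" x] by (intro mult_left_mono) auto
    also have "\<dots> = L * t * (norm d)\<^sup>2"
      using that by (simp add: power2_eq_square)
    finally show ?thesis by simp
  qed
  have "\<phi> 1 \<le> \<phi> 0"
  proof (rule DERIV_nonpos_imp_nonincreasing[of 0 1 \<phi>])
    show "\<exists>y. DERIV \<phi> t :> y \<and> y \<le> 0" if "0 \<le> t" "t \<le> 1" for t
      using deriv nonpos[OF that(1)] by blast
  qed simp
  then show ?thesis
    by (simp add: \<phi>_def d_def)
qed

text \<open>Functions measurable in one variable and continuous in the other (Caratheodory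
  functions): with x replaced by a simple approximation \<open>S i x\<close>, only finitely many
  sections occur, and continuity in x recovers the function as a pointwise limit.\<close>

lemma borel_measurable_pair_continuous:
  fixes F :: "'a::{second_countable_topology, metric_space} \<Rightarrow> 'z \<Rightarrow> 'b::metric_space"
  assumes meas: "\<And>x. F x \<in> borel_measurable Z"
    and cont: "\<And>x z. z \<in> space Z \<Longrightarrow> isCont (\<lambda>y. F y z) x"
  shows "(\<lambda>(x, z). F x z) \<in> borel_measurable (borel \<Otimes>\<^sub>M Z)"
proof -
  have "(\<lambda>x::'a. x) \<in> borel_measurable borel"
    by simp
  then obtain S :: "nat \<Rightarrow> 'a \<Rightarrow> 'a" where
    S: "\<And>i. simple_function borel (S i)" "\<And>x. (\<lambda>i. S i x) \<longlonglongrightarrow> x"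
    using borel_measurable_implies_sequence_metric[where f = "\<lambda>x. x" and M = "borel :: 'a measure"]
    by (metis UNIV_I space_borel)
  show ?thesis
  proof (rule borel_measurable_LIMSEQ_metric)
    fix i
    have "(\<lambda>p. F (S i (fst p)) (snd p)) \<in> borel_measurable (borel \<Otimes>\<^sub>M Z)"
    proof (rule measurable_compose_countable'[where I = "range (S i)"])
      show "countable (range (S i))"
        using simple_functionD(1)[OF S(1)[of i]] by (simp add: countable_finite)
      have "S i \<in> measurable borel (count_space (range (S i)))"
        using S(1)[of i]
        by (intro measurable_count_space_eq2[THEN iffD2]) (auto simp: simple_function_def)
      then show "(\<lambda>p. S i (fst p)) \<in> measurable (borel \<Otimes>\<^sub>M Z) (count_space (range (S i)))"
        by measurable
      show "(\<lambda>p. F a (snd p)) \<in> borel_measurable (borel \<Otimes>\<^sub>M Z)" for a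
        using meas[of a] by measurable
    qed
    then show "(\<lambda>p. F (S i (fst p)) (snd p)) \<in> borel_measurable (borel \<Otimes>\<^sub>M Z)" .
  next
    fix p :: "'a \<times> 'z"
    assume "p \<in> space (borel \<Otimes>\<^sub>M Z)"
    then have "isCont (\<lambda>y. F y (snd p)) (fst p)"
      by (intro cont) (auto simp: space_pair_measure)
    then show "(\<lambda>i. F (S i (fst p)) (snd p)) \<longlonglongrightarrow> (case p of (x, z) \<Rightarrow> F x z)"
      using isCont_tendsto_compose[of "fst p" "\<lambda>y. F y (snd p)"] S(2)[of "fst p"]
      by (simp add: case_prod_beta)
  qed
qed

text \<open>Each coordinate of the gradient is a limit of difference quotients, which are jointly
  measurable by the previous lemma. Joint measurability is what permits inserting a random model
  into the gradient.\<close>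

lemma borel_measurable_pair_grad:
  fixes F :: "'a::euclidean_space \<Rightarrow> 'z \<Rightarrow> real"
  assumes meas: "\<And>x. F x \<in> borel_measurable Z"
    and diff: "\<And>x z. z \<in> space Z \<Longrightarrow> (\<lambda>y. F y z) differentiable (at x)"
  shows "(\<lambda>(x, z). grad (\<lambda>y. F y z) x) \<in> borel_measurable (borel \<Otimes>\<^sub>M Z)"
proof (rule borel_measurable_euclidean_space[THEN iffD2], intro ballI)
  fix b :: 'a
  assume "b \<in> Basis"
  have F[measurable]: "(\<lambda>(x, z). F x z) \<in> borel_measurable (borel \<Otimes>\<^sub>M Z)"
    using meas diff by (intro borel_measurable_pair_continuous differentiable_imp_continuous_within)
  \<comment> \<open>\<open>Suc\<close> keeps the step sizes nonzero, so that they tend to 0 within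
    the punctured neighbourhood.\<close>
  define h where "h = (\<lambda>n::nat. 1 / real (Suc n))"
  show "(\<lambda>p. inner (case p of (x, z) \<Rightarrow> grad (\<lambda>y. F y z) x) b) \<in> borel_measurable (borel \<Otimes>\<^sub>M Z)"
  proof (rule borel_measurable_LIMSEQ_real)
    fix n
    have "(\<lambda>p. (fst p + h n *\<^sub>R b, snd p)) \<in> borel \<Otimes>\<^sub>M Z \<rightarrow>\<^sub>M borel \<Otimes>\<^sub>M Z"
      by measurable
    from measurable_compose[OF this F]
    show "(\<lambda>p. (F (fst p + h n *\<^sub>R b) (snd p) - F (fst p) (snd p)) / h n)
        \<in> borel_measurable (borel \<Otimes>\<^sub>M Z)"
      using F by (auto simp: case_prod_beta)
  next
    fix p :: "'a \<times> 'z"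
    assume "p \<in> space (borel \<Otimes>\<^sub>M Z)"
    then obtain x z where p: "p = (x, z)" "z \<in> space Z"
      by (auto simp: space_pair_measure)
    have "GDERIV (\<lambda>y. F y z) x :> grad (\<lambda>y. F y z) x"
      using diff p by (intro differentiable_imp_GDERIV_grad)
    \<comment> \<open>The base point is written as \<open>x + 0 *\<^sub>R b\<close> to match the
      curve t \<mapsto> x + t b at t = 0 in the chain rule.\<close>
    then have "((\<lambda>y. F y z) has_derivative (\<lambda>v. inner v (grad (\<lambda>y. F y z) x))) (at (x + 0 *\<^sub>R b))"
      by (simp add: gderiv_def)
    moreover have "((\<lambda>t. x + t *\<^sub>R b) has_derivative (\<lambda>t. t *\<^sub>R b)) (at 0)"
      by (auto intro!: derivative_eq_intros)
    ultimately have "((\<lambda>t. F (x + t *\<^sub>R b) z) has_derivative (\<lambda>t. inner (t *\<^sub>R b) (grad (\<lambda>y. F y z) x))) (at 0)"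
      by (rule has_derivative_compose[rotated])
    then have "((\<lambda>t. F (x + t *\<^sub>R b) z) has_real_derivative inner (grad (\<lambda>y. F y z) x) b) (at 0)"
      by (simp add: has_field_derivative_def mult.commute[of _ "inner _ _"] inner_commute)
    then have "(\<lambda>t. (F (x + t *\<^sub>R b) z - F x z) / t) \<midarrow>0\<rightarrow> inner (grad (\<lambda>y. F y z) x) b"
      by (simp add: DERIV_def)
    moreover have "filterlim h (at 0) sequentially"
      unfolding filterlim_at h_def using LIMSEQ_inverse_real_of_nat
      by (auto simp: inverse_eq_divide simp del: of_nat_Suc)
    ultimately show "(\<lambda>n. (F (fst p + h n *\<^sub>R b) (snd p) - F (fst p) (snd p)) / h n)
        \<longlonglongrightarrow> inner (case p of (x, z) \<Rightarrow> grad (\<lambda>y. F y z) x) b"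
      unfolding p by (auto dest: filterlim_compose)
  qed
qed

subsection \<open>Draws independent of the past\<close>

text \<open>Families of events rather than random variables let draws of different types share one
  index set. Intersection stability is what carries independence over to the generated
  sigma-algebras.\<close>

locale indep_events = prob_space M for M :: "'w measure" +
  fixes E :: "'j \<Rightarrow> 'w set set" and J :: "'j set"
  assumes indep: "indep_sets E J"
    and stable: "\<And>j. j \<in> J \<Longrightarrow> Int_stable (E j)"
begin

text \<open>The sigma-algebra generated by the draws in \<open>I\<close>, packaged as a measure so
  that adaptedness reads \<open>measurable (past I)\<close>; the measure on it is never evaluated.
  The intersection with \<open>J\<close> lets \<open>I\<close> contain indices that are not actual
  draws, as \<open>hist\<close> below does.\<close>

definition past :: "'j set \<Rightarrow> 'w measure" where
  "past I = sigma (space M) (\<Union>i\<in>I \<inter> J. E i)"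

lemma E_events: "j \<in> J \<Longrightarrow> E j \<subseteq> events"
  using indep by (simp add: indep_sets_def)

lemma E_Pow: "(\<Union>i\<in>I \<inter> J. E i) \<subseteq> Pow (space M)"
  using E_events sets.sets_into_space by blast

lemma space_past [simp]: "space (past I) = space M"
  by (simp add: past_def space_measure_of_conv)

lemma sets_past: "sets (past I) = sigma_sets (space M) (\<Union>i\<in>I \<inter> J. E i)"
  unfolding past_def using E_Pow by simp

lemma subalgebra_past: "subalgebra M (past I)"
  unfolding subalgebra_def sets_past using E_events by (auto intro!: sets.sigma_sets_subset)

lemma measurable_past: "X \<in> measurable (past I) S \<Longrightarrow> X \<in> measurable M S"
  using measurable_from_subalg[OF subalgebra_past] .

lemma measurable_past_mono:
  assumes "X \<in> measurable (past I) S" "I \<subseteq> I'"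
  shows "X \<in> measurable (past I') S"
proof -
  have "subalgebra (past I') (past I)"
    unfolding subalgebra_def sets_past using assms(2) by (auto intro!: sigma_sets_mono')
  then show ?thesis
    using assms(1) measurable_from_subalg by blast
qed

text \<open>The value type of \<open>Y\<close> is free, so the same lemmas serve both samples and
  quantizer seeds.\<close>

definition is_draw :: "'j \<Rightarrow> ('w \<Rightarrow> 't) \<Rightarrow> 't measure \<Rightarrow> bool" where
  "is_draw j Y T \<longleftrightarrow>
     j \<in> J \<and> Y \<in> measurable M T \<and> (\<forall>C\<in>sets T. Y -` C \<inter> space M \<in> E j)"

lemma measurable_draw: "is_draw j Y T \<Longrightarrow> Y \<in> measurable M T"
  by (simp add: is_draw_def)

lemma measurable_past_draw:
  assumes "is_draw j Y T" "j \<in> I"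
  shows "Y \<in> measurable (past I) T"
  using assms by (auto simp: is_draw_def measurable_def sets_past intro!: sigma_sets.Basic)

text \<open>Splitting the family into the disjoint blocks \<open>I \<inter> J\<close> and
  \<open>{j}\<close>, labelled by the two booleans, makes the sigma-algebras generated by the blocks
  independent.\<close>

lemma prob_past_Int_new:
  assumes "j \<in> J" "j \<notin> I" "A \<in> sets (past I)" "C \<in> E j"
  shows "prob (A \<inter> C) = prob A * prob C"
proof -
  define I' where "I' = case_bool (I \<inter> J) {j}"
  have "indep_sets (\<lambda>i. sigma_sets (space M) (\<Union>i\<in>I' i. E i)) UNIV"
  proof (rule indep_sets_collect_sigma)
    show "indep_sets E (\<Union>i\<in>UNIV. I' i)"
      using indep assms(1) by (intro indep_sets_mono_index[OF _ indep]) (auto simp: I'_def split: bool.splits)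
    show "Int_stable (E i)" if "b \<in> UNIV" "i \<in> I' b" for i b
      using that assms(1) by (intro stable) (auto simp: I'_def split: bool.splits)
    show "disjoint_family_on I' UNIV"
      using assms(2) by (auto simp: disjoint_family_on_def I'_def split: bool.splits)
  qed
  then have "prob (\<Inter>b\<in>UNIV. case_bool A C b) = (\<Prod>b\<in>UNIV. prob (case_bool A C b))"
    by (rule indep_setsD)
      (use assms in \<open>auto simp: sets_past I'_def intro: sigma_sets.Basic split: bool.splits\<close>)
  then show ?thesis
    by (simp add: UNIV_bool Int_commute mult.commute)
qed

text \<open>Both sides are determined by their values on rectangles, where the claim is
  \<open>prob_past_Int_new\<close>.\<close>

lemma distr_past_new:
  assumes j: "is_draw j Y T" "j \<notin> I"
    and X: "X \<in> measurable (past I) S"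
  shows "distr M (S \<Otimes>\<^sub>M T) (\<lambda>\<omega>. (X \<omega>, Y \<omega>)) = distr M S X \<Otimes>\<^sub>M distr M T Y"
proof (rule pair_measure_eqI[symmetric])
  have [measurable]: "X \<in> measurable M S" "Y \<in> measurable M T"
    using measurable_past[OF X] measurable_draw[OF j(1)] by auto
  interpret X: prob_space "distr M S X" by (rule prob_space_distr) simp
  interpret Y: prob_space "distr M T Y" by (rule prob_space_distr) simp
  show "sigma_finite_measure (distr M S X)" "sigma_finite_measure (distr M T Y)"
    by unfold_locales
  show "sets (distr M S X \<Otimes>\<^sub>M distr M T Y) = sets (distr M (S \<Otimes>\<^sub>M T) (\<lambda>\<omega>. (X \<omega>, Y \<omega>)))"
    by (simp cong: sets_pair_measure_cong)
  fix A C
  assume "A \<in> sets (distr M S X)" "C \<in> sets (distr M T Y)"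
  then have [measurable]: "A \<in> sets S" "C \<in> sets T" by auto
  have "prob ((X -` A \<inter> space M) \<inter> (Y -` C \<inter> space M)) = prob (X -` A \<inter> space M) * prob (Y -` C \<inter> space M)"
    using measurable_sets[OF X, of A] j by (intro prob_past_Int_new[of j I]) (auto simp: is_draw_def)
  moreover have "(\<lambda>\<omega>. (X \<omega>, Y \<omega>)) -` (A \<times> C) \<inter> space M = (X -` A \<inter> space M) \<inter> (Y -` C \<inter> space M)"
    by auto
  ultimately show "emeasure (distr M S X) A * emeasure (distr M T Y) C
      = emeasure (distr M (S \<Otimes>\<^sub>M T) (\<lambda>\<omega>. (X \<omega>, Y \<omega>))) (A \<times> C)"
    by (simp add: emeasure_distr emeasure_eq_measure ennreal_mult)
qed

lemma
  fixes h :: "'s \<times> 't \<Rightarrow> 'a::euclidean_space"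
  assumes j: "is_draw j Y T" "j \<notin> I"
    and X: "X \<in> measurable (past I) S"
    and h: "h \<in> borel_measurable (S \<Otimes>\<^sub>M T)"
    and int: "\<And>x. x \<in> space S \<Longrightarrow> integrable (distr M T Y) (\<lambda>t. (norm (h (x, t)))\<^sup>2)"
    and le: "\<And>x. x \<in> space S \<Longrightarrow> (\<integral>t. (norm (h (x, t)))\<^sup>2 \<partial>distr M T Y) \<le> c x"
    and c: "c \<in> borel_measurable S" "integrable M (\<lambda>\<omega>. c (X \<omega>))"
  shows integrable_norm2_past_new: "integrable M (\<lambda>\<omega>. (norm (h (X \<omega>, Y \<omega>)))\<^sup>2)"
    and integral_norm2_past_new: "(\<integral>\<omega>. (norm (h (X \<omega>, Y \<omega>)))\<^sup>2 \<partial>M) \<le> (\<integral>\<omega>. c (X \<omega>) \<partial>M)"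
proof -
  note [measurable] = measurable_past[OF X] measurable_draw[OF j(1)] h c(1)
  interpret Y: prob_space "distr M T Y" by (rule prob_space_distr) simp
  have c0: "0 \<le> c x" if "x \<in> space S" for x
    using le[OF that] by (rule order_trans[rotated]) simp
  have c0': "AE \<omega> in M. 0 \<le> c (X \<omega>)"
    using measurable_space[OF measurable_past[OF X]] c0 by auto
  have "(\<integral>\<^sup>+\<omega>. ennreal ((norm (h (X \<omega>, Y \<omega>)))\<^sup>2) \<partial>M)
      = (\<integral>\<^sup>+p. ennreal ((norm (h p))\<^sup>2) \<partial>distr M (S \<Otimes>\<^sub>M T) (\<lambda>\<omega>. (X \<omega>, Y \<omega>)))"
    by (subst nn_integral_distr) auto
  also have "\<dots> = (\<integral>\<^sup>+x. \<integral>\<^sup>+t. ennreal ((norm (h (x, t)))\<^sup>2) \<partial>distr M T Y \<partial>distr M S X)"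
    unfolding distr_past_new[OF j X] by (subst Y.nn_integral_fst[symmetric]) auto
  also have "\<dots> \<le> (\<integral>\<^sup>+x. ennreal (c x) \<partial>distr M S X)"
  proof (rule nn_integral_mono)
    fix x assume "x \<in> space (distr M S X)"
    then have x: "x \<in> space S" by simp
    show "(\<integral>\<^sup>+t. ennreal ((norm (h (x, t)))\<^sup>2) \<partial>distr M T Y) \<le> ennreal (c x)"
      using le[OF x] by (subst nn_integral_eq_integral[OF int[OF x]]) (auto intro: ennreal_leI)
  qed
  also have "\<dots> = (\<integral>\<^sup>+\<omega>. ennreal (c (X \<omega>)) \<partial>M)"
    by (subst nn_integral_distr) auto
  also have "\<dots> = ennreal (\<integral>\<omega>. c (X \<omega>) \<partial>M)"
    using c(2) c0' by (rule nn_integral_eq_integral)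
  finally have *: "(\<integral>\<^sup>+\<omega>. ennreal ((norm (h (X \<omega>, Y \<omega>)))\<^sup>2) \<partial>M) \<le> ennreal (\<integral>\<omega>. c (X \<omega>) \<partial>M)" .
  show int': "integrable M (\<lambda>\<omega>. (norm (h (X \<omega>, Y \<omega>)))\<^sup>2)"
    using * by (intro integrableI_nonneg) (auto intro: le_less_trans)
  have "0 \<le> (\<integral>\<omega>. c (X \<omega>) \<partial>M)"
    using c0' by (rule integral_nonneg_AE)
  then show "(\<integral>\<omega>. (norm (h (X \<omega>, Y \<omega>)))\<^sup>2 \<partial>M) \<le> (\<integral>\<omega>. c (X \<omega>) \<partial>M)"
    using * by (subst (asm) nn_integral_eq_integral[OF int']) auto
qed

lemma integral_past_new:
  fixes h :: "'s \<times> 't \<Rightarrow> real"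
  assumes j: "is_draw j Y T" "j \<notin> I"
    and X: "X \<in> measurable (past I) S"
    and h: "h \<in> borel_measurable (S \<Otimes>\<^sub>M T)" "integrable M (\<lambda>\<omega>. h (X \<omega>, Y \<omega>))"
  shows "(\<integral>\<omega>. h (X \<omega>, Y \<omega>) \<partial>M) = (\<integral>\<omega>. (\<integral>t. h (X \<omega>, t) \<partial>distr M T Y) \<partial>M)"
proof -
  note [measurable] = measurable_past[OF X] measurable_draw[OF j(1)] h(1)
  interpret X: prob_space "distr M S X" by (rule prob_space_distr) simp
  interpret Y: prob_space "distr M T Y" by (rule prob_space_distr) simp
  interpret XY: pair_sigma_finite "distr M S X" "distr M T Y" ..
  have int: "integrable (distr M S X \<Otimes>\<^sub>M distr M T Y) h"
    unfolding distr_past_new[OF j X, symmetric] by (subst integrable_distr_eq) (auto intro: h)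
  have "(\<integral>\<omega>. h (X \<omega>, Y \<omega>) \<partial>M) = (\<integral>p. h p \<partial>(distr M S X \<Otimes>\<^sub>M distr M T Y))"
    unfolding distr_past_new[OF j X, symmetric] by (subst integral_distr) auto
  also have "\<dots> = (\<integral>x. (\<integral>t. h (x, t) \<partial>distr M T Y) \<partial>distr M S X)"
    by (rule XY.integral_fst'[OF int, symmetric])
  also have "\<dots> = (\<integral>\<omega>. (\<integral>t. h (X \<omega>, t) \<partial>distr M T Y) \<partial>M)"
    by (subst integral_distr) auto
  finally show ?thesis .
qed

end

subsection \<open>Square-integrable random vectors\<close>

lemma norm_sum_power2_le:
  fixes x :: "'i \<Rightarrow> 'a::real_normed_vector"
  shows "(norm (\<Sum>i\<in>I. x i))\<^sup>2 \<le> real (card I) * (\<Sum>i\<in>I. (norm (x i))\<^sup>2)"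
proof -
  have "(norm (\<Sum>i\<in>I. x i))\<^sup>2 \<le> (\<Sum>i\<in>I. norm (x i))\<^sup>2"
    by (intro power_mono norm_sum) auto
  also have "\<dots> \<le> real (card I) * (\<Sum>i\<in>I. (norm (x i))\<^sup>2)"
    using sum_squared_le_sum_of_squares[of "\<lambda>i. norm (x i)" I] by (simp add: mult.commute)
  finally show ?thesis .
qed

lemma norm_add_power2_le:
  fixes x y :: "'a::real_inner"
  shows "(norm (x + y))\<^sup>2 \<le> 2 * (norm x)\<^sup>2 + 2 * (norm y)\<^sup>2"
  using zero_le_power2[of "norm (x - y)"]
  by (simp add: power2_norm_eq_inner inner_simps inner_commute)

lemma abs_inner_le_norm_power2:
  fixes x y :: "'a::real_inner"
  shows "\<bar>inner x y\<bar> \<le> (norm x)\<^sup>2 + (norm y)\<^sup>2"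
proof -
  have "\<bar>inner x y\<bar> \<le> norm x * norm y"
    by (rule Cauchy_Schwarz_ineq2)
  also have "\<dots> \<le> (norm x)\<^sup>2 + (norm y)\<^sup>2"
    using sum_squares_bound[of "norm x" "norm y"] mult_nonneg_nonneg[of "norm x" "norm y"]
    unfolding mult.assoc by (smt (verit) norm_ge_zero)
  finally show ?thesis .
qed

text \<open>The integral of a non-integrable function defaults to 0, which would break linearity;
  membership in this set is the standing condition under which squared norms and inner products may
  be split.\<close>

definition L2 :: "'w measure \<Rightarrow> ('w \<Rightarrow> 'a::euclidean_space) set" where
  "L2 M = {X \<in> borel_measurable M. integrable M (\<lambda>\<omega>. (norm (X \<omega>))\<^sup>2)}"

lemma L2_measurable [measurable_dest]: "X \<in> L2 M \<Longrightarrow> X \<in> borel_measurable M"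
  by (simp add: L2_def)

lemma L2_integrable: "X \<in> L2 M \<Longrightarrow> integrable M (\<lambda>\<omega>. (norm (X \<omega>))\<^sup>2)"
  by (simp add: L2_def)

lemma L2_add:
  assumes "X \<in> L2 M" "Y \<in> L2 M"
  shows "(\<lambda>\<omega>. X \<omega> + Y \<omega>) \<in> L2 M"
proof -
  have [measurable]: "X \<in> borel_measurable M" "Y \<in> borel_measurable M"
    using assms by (auto simp: L2_def)
  have "integrable M (\<lambda>\<omega>. 2 * (norm (X \<omega>))\<^sup>2 + 2 * (norm (Y \<omega>))\<^sup>2)"
    using assms by (intro Bochner_Integration.integrable_add integrable_mult_right) (auto simp: L2_def)
  then have "integrable M (\<lambda>\<omega>. (norm (X \<omega> + Y \<omega>))\<^sup>2)"
    by (rule Bochner_Integration.integrable_bound) (auto intro!: norm_add_power2_le)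
  then show ?thesis
    by (simp add: L2_def)
qed

lemma L2_scaleR: "X \<in> L2 M \<Longrightarrow> (\<lambda>\<omega>. c *\<^sub>R X \<omega>) \<in> L2 M"
  by (auto simp: L2_def power_mult_distrib)

lemma L2_diff: "X \<in> L2 M \<Longrightarrow> Y \<in> L2 M \<Longrightarrow> (\<lambda>\<omega>. X \<omega> - Y \<omega>) \<in> L2 M"
  using L2_add[of X M "\<lambda>\<omega>. (-1) *\<^sub>R Y \<omega>"] L2_scaleR[of Y M "-1"] by simp

lemma L2_sum: "(\<And>i. i \<in> I \<Longrightarrow> X i \<in> L2 M) \<Longrightarrow> (\<lambda>\<omega>. \<Sum>i\<in>I. X i \<omega>) \<in> L2 M"
proof (induction I rule: infinite_finite_induct)
  case (insert i I)
  then show ?case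
    by (simp add: L2_add)
qed (auto simp: L2_def)

lemma L2_inner_integrable:
  assumes "X \<in> L2 M" "Y \<in> L2 M"
  shows "integrable M (\<lambda>\<omega>. inner (X \<omega>) (Y \<omega>))"
proof (rule Bochner_Integration.integrable_bound)
  show "integrable M (\<lambda>\<omega>. (norm (X \<omega>))\<^sup>2 + (norm (Y \<omega>))\<^sup>2)"
    using assms by (auto simp: L2_def)
  show "(\<lambda>\<omega>. inner (X \<omega>) (Y \<omega>)) \<in> borel_measurable M"
    using assms by (auto simp: L2_def)
qed (auto intro: abs_inner_le_norm_power2)

lemma integral_norm2_add:
  assumes "X \<in> L2 M" "Y \<in> L2 M"
  shows "(\<integral>\<omega>. (norm (X \<omega> + Y \<omega>))\<^sup>2 \<partial>M) =
    (\<integral>\<omega>. (norm (X \<omega>))\<^sup>2 \<partial>M) + 2 * (\<integral>\<omega>. inner (X \<omega>) (Y \<omega>) \<partial>M) + (\<integral>\<omega>. (norm (Y \<omega>))\<^sup>2 \<partial>M)"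
proof -
  have "(\<integral>\<omega>. (norm (X \<omega> + Y \<omega>))\<^sup>2 \<partial>M) =
      (\<integral>\<omega>. (norm (X \<omega>))\<^sup>2 + 2 * inner (X \<omega>) (Y \<omega>) + (norm (Y \<omega>))\<^sup>2 \<partial>M)"
    by (rule Bochner_Integration.integral_cong)
      (simp_all add: power2_norm_eq_inner inner_simps inner_commute)
  then show ?thesis
    using assms L2_inner_integrable[OF assms] by (simp add: L2_integrable)
qed

lemma integral_norm2_add_le:
  assumes "X \<in> L2 M" "Y \<in> L2 M"
  shows "(\<integral>\<omega>. (norm (X \<omega> + Y \<omega>))\<^sup>2 \<partial>M) \<le>
    2 * (\<integral>\<omega>. (norm (X \<omega>))\<^sup>2 \<partial>M) + 2 * (\<integral>\<omega>. (norm (Y \<omega>))\<^sup>2 \<partial>M)"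
proof -
  have "(\<integral>\<omega>. (norm (X \<omega> + Y \<omega>))\<^sup>2 \<partial>M) \<le> (\<integral>\<omega>. 2 * (norm (X \<omega>))\<^sup>2 + 2 * (norm (Y \<omega>))\<^sup>2 \<partial>M)"
    using assms L2_integrable[OF L2_add[OF assms]]
    by (intro integral_mono norm_add_power2_le) (auto simp: L2_integrable)
  then show ?thesis
    using assms by (simp add: L2_integrable)
qed

lemma integral_norm2_sum_le:
  assumes "\<And>i. i \<in> I \<Longrightarrow> X i \<in> L2 M"
  shows "(\<integral>\<omega>. (norm (\<Sum>i\<in>I. X i \<omega>))\<^sup>2 \<partial>M) \<le> real (card I) * (\<Sum>i\<in>I. \<integral>\<omega>. (norm (X i \<omega>))\<^sup>2 \<partial>M)"
proof -
  have "(\<integral>\<omega>. (norm (\<Sum>i\<in>I. X i \<omega>))\<^sup>2 \<partial>M) \<le> (\<integral>\<omega>. real (card I) * (\<Sum>i\<in>I. (norm (X i \<omega>))\<^sup>2) \<partial>M)"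
    using assms L2_integrable[OF L2_sum[OF assms]]
    by (intro integral_mono norm_sum_power2_le integrable_mult_right Bochner_Integration.integrable_sum)
      (auto simp: L2_integrable)
  then show ?thesis
    using assms by (simp add: L2_integrable Bochner_Integration.integral_sum)
qed

text \<open>Cauchy-Schwarz without any orthogonality. The squared cardinality cancels when the sum
  is turned into an average.\<close>

lemma integral_norm2_sum_le_square:
  assumes "\<And>i. i \<in> I \<Longrightarrow> X i \<in> L2 M" "\<And>i. i \<in> I \<Longrightarrow> (\<integral>\<omega>. (norm (X i \<omega>))\<^sup>2 \<partial>M) \<le> c"
  shows "(\<integral>\<omega>. (norm (\<Sum>i\<in>I. X i \<omega>))\<^sup>2 \<partial>M) \<le> (real (card I))\<^sup>2 * c"
proof -
  have "(\<Sum>i\<in>I. \<integral>\<omega>. (norm (X i \<omega>))\<^sup>2 \<partial>M) \<le> real (card I) * c"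
    using assms(2) by (intro sum_bounded_above) auto
  then have "real (card I) * (\<Sum>i\<in>I. \<integral>\<omega>. (norm (X i \<omega>))\<^sup>2 \<partial>M) \<le> real (card I) * (real (card I) * c)"
    by (rule mult_left_mono) simp
  then show ?thesis
    using integral_norm2_sum_le[of I X M] assms(1) by (simp add: power2_eq_square mult.assoc)
qed

lemma integral_norm2_scaleR:
  "(\<integral>\<omega>. (norm (c *\<^sub>R X \<omega>))\<^sup>2 \<partial>M) = c\<^sup>2 * (\<integral>\<omega>. (norm (X \<omega>))\<^sup>2 \<partial>M)"
  by (simp add: power_mult_distrib)

lemma integral_inner_sum:
  assumes "W \<in> L2 M" "\<And>i. i \<in> I \<Longrightarrow> X i \<in> L2 M"
  shows "(\<integral>\<omega>. inner (W \<omega>) (\<Sum>i\<in>I. X i \<omega>) \<partial>M) = (\<Sum>i\<in>I. \<integral>\<omega>. inner (W \<omega>) (X i \<omega>) \<partial>M)"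
  using assms by (simp add: inner_sum_right Bochner_Integration.integral_sum L2_inner_integrable)

text \<open>Without cross terms the bound grows linearly instead of quadratically in the number of
  summands; this is the source of the variance reduction by mini-batches and workers.\<close>

lemma integral_norm2_sum_orthogonal:
  assumes "finite I" "\<And>i. i \<in> I \<Longrightarrow> X i \<in> L2 M"
    and "\<And>i j. i \<in> I \<Longrightarrow> j \<in> I \<Longrightarrow> i \<noteq> j \<Longrightarrow> (\<integral>\<omega>. inner (X i \<omega>) (X j \<omega>) \<partial>M) = 0"
  shows "(\<integral>\<omega>. (norm (\<Sum>i\<in>I. X i \<omega>))\<^sup>2 \<partial>M) = (\<Sum>i\<in>I. \<integral>\<omega>. (norm (X i \<omega>))\<^sup>2 \<partial>M)"
  using assms
proof (induction I rule: finite_induct)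
  case (insert i I)
  have "(\<integral>\<omega>. inner (X i \<omega>) (\<Sum>j\<in>I. X j \<omega>) \<partial>M) = (\<Sum>j\<in>I. \<integral>\<omega>. inner (X i \<omega>) (X j \<omega>) \<partial>M)"
    using insert.prems by (intro integral_inner_sum) auto
  also have "\<dots> = 0"
    using insert.prems(2) insert.hyps by (intro sum.neutral) auto
  finally show ?case
    using insert by (simp add: integral_norm2_add L2_sum)
qed simp

section \<open>Lipschitz and smooth functions of square-integrable vectors\<close>

context finite_measure
begin

lemma L2_const: "(\<lambda>\<omega>. c) \<in> L2 M"
  by (simp add: L2_def)

lemma L2_Lipschitz:
  fixes g :: "'b::euclidean_space \<Rightarrow> 'c::euclidean_space"
  assumes Lipschitz: "\<And>x y. norm (g x - g y) \<le> C * norm (x - y)" and X: "X \<in> L2 M"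
  shows "(\<lambda>\<omega>. g (X \<omega>)) \<in> L2 M"
proof -
  \<comment> \<open>\<open>lipschitz_on\<close> demands a nonnegative constant, while the sign of
    \<open>C\<close> is unknown here.\<close>
  have "\<bar>C\<bar>-lipschitz_on UNIV g"
  proof (rule lipschitz_onI)
    fix x y
    have "dist (g x) (g y) \<le> C * dist x y"
      using Lipschitz[of x y] by (simp add: dist_norm)
    also have "\<dots> \<le> \<bar>C\<bar> * dist x y"
      by (intro mult_right_mono) auto
    finally show "dist (g x) (g y) \<le> \<bar>C\<bar> * dist x y" .
  qed simp
  then have [measurable]: "g \<in> borel_measurable borel"
    by (intro borel_measurable_continuous_onI lipschitz_on_continuous_on)
  have [measurable]: "X \<in> borel_measurable M"
    using X by (rule L2_measurable)
  have "integrable M (\<lambda>\<omega>. (norm (g (X \<omega>) - g 0))\<^sup>2)"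
  proof (rule Bochner_Integration.integrable_bound)
    show "integrable M (\<lambda>\<omega>. C\<^sup>2 * (norm (X \<omega>))\<^sup>2)"
      using X by (simp add: L2_integrable)
    have "(norm (g x - g 0))\<^sup>2 \<le> C\<^sup>2 * (norm x)\<^sup>2" for x
      using power_mono[OF Lipschitz[of x 0], of 2] by (simp add: power_mult_distrib)
    then show "AE \<omega> in M. norm ((norm (g (X \<omega>) - g 0))\<^sup>2) \<le> norm (C\<^sup>2 * (norm (X \<omega>))\<^sup>2)"
      by simp
  qed measurable
  then have "(\<lambda>\<omega>. g (X \<omega>) - g 0) \<in> L2 M"
    by (simp add: L2_def)
  then show ?thesis
    using L2_add[OF _ L2_const[of "g 0"], of "\<lambda>\<omega>. g (X \<omega>) - g 0"] by simp
qed

text \<open>From above \<open>f\<close> is controlled by its quadratic bound around 0, from below by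
  \<open>l\<close>; hence its absolute value grows at most quadratically.\<close>

lemma integrable_smooth:
  fixes f :: "'b::euclidean_space \<Rightarrow> real"
  assumes grad: "\<And>x. GDERIV f x :> g x"
    and Lipschitz: "\<And>x y. norm (g x - g y) \<le> C * norm (x - y)"
    and lower: "\<And>x. l \<le> f x"
    and X: "X \<in> L2 M"
  shows "integrable M (\<lambda>\<omega>. f (X \<omega>))"
proof (rule Bochner_Integration.integrable_bound)
  show "integrable M (\<lambda>\<omega>. \<bar>l\<bar> + \<bar>f 0\<bar> + (norm (g 0))\<^sup>2 + (1 + \<bar>C\<bar> / 2) * (norm (X \<omega>))\<^sup>2)"
    using X by (simp add: L2_integrable)
  have "isCont f x" for x
    using grad[of x] unfolding gderiv_def by (rule has_derivative_continuous)
  then have [measurable]: "f \<in> borel_measurable borel"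
    by (intro borel_measurable_continuous_onI) (simp add: continuous_at_imp_continuous_on)
  show "(\<lambda>\<omega>. f (X \<omega>)) \<in> borel_measurable M"
    using L2_measurable[OF X] by measurable
  have "\<bar>f x\<bar> \<le> \<bar>l\<bar> + \<bar>f 0\<bar> + (norm (g 0))\<^sup>2 + (1 + \<bar>C\<bar> / 2) * (norm x)\<^sup>2" for x
  proof -
    have "f x \<le> f 0 + inner (g 0) x + C / 2 * (norm x)\<^sup>2"
      using GDERIV_Lipschitz_upper_bound[OF grad Lipschitz, of x 0] by simp
    moreover have "C / 2 * (norm x)\<^sup>2 \<le> \<bar>C\<bar> / 2 * (norm x)\<^sup>2" "0 \<le> \<bar>C\<bar> / 2 * (norm x)\<^sup>2"
      by (auto intro: mult_right_mono)
    moreover have "\<bar>inner (g 0) x\<bar> \<le> (norm (g 0))\<^sup>2 + (norm x)\<^sup>2"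
      by (rule abs_inner_le_norm_power2)
    ultimately show ?thesis
      using lower[of x] zero_le_power2[of "norm x"] zero_le_power2[of "norm (g 0)"]
      unfolding distrib_right by linarith
  qed
  then show "AE \<omega> in M. norm (f (X \<omega>)) \<le>
      norm (\<bar>l\<bar> + \<bar>f 0\<bar> + (norm (g 0))\<^sup>2 + (1 + \<bar>C\<bar> / 2) * (norm (X \<omega>))\<^sup>2)"
    by (intro AE_I2) (metis abs_ge_self order_trans real_norm_def)
qed

end

section \<open>Square integrability and orthogonality for functions of a new draw\<close>

context indep_events
begin

lemma L2_draw:
  fixes h :: "'s \<times> 't \<Rightarrow> 'a::euclidean_space"
  assumes "is_draw j Y T" "j \<notin> I" "X \<in> measurable (past I) S"
    and "h \<in> borel_measurable (S \<Otimes>\<^sub>M T)"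
    and "\<And>x. x \<in> space S \<Longrightarrow> integrable (distr M T Y) (\<lambda>t. (norm (h (x, t)))\<^sup>2)"
    and "\<And>x. x \<in> space S \<Longrightarrow> (\<integral>t. (norm (h (x, t)))\<^sup>2 \<partial>distr M T Y) \<le> c x"
    and "c \<in> borel_measurable S" "integrable M (\<lambda>\<omega>. c (X \<omega>))"
  shows "(\<lambda>\<omega>. h (X \<omega>, Y \<omega>)) \<in> L2 M"
  using integrable_norm2_past_new[OF assms] measurable_past[OF assms(3)]
    measurable_draw[OF assms(1)] assms(4)
  by (simp add: L2_def)

text \<open>Orthogonality of martingale differences: with the pair of \<open>W\<close> and
  \<open>X\<close> frozen, integrating over the new draw first moves the integral inside the inner
  product, where the mean is zero.\<close>

lemma integral_inner_draw:
  fixes h :: "'s \<times> 't \<Rightarrow> 'a::euclidean_space"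
  assumes j: "is_draw j Y T" "j \<notin> I"
    and X: "X \<in> measurable (past I) S"
    and h: "h \<in> borel_measurable (S \<Otimes>\<^sub>M T)" "(\<lambda>\<omega>. h (X \<omega>, Y \<omega>)) \<in> L2 M"
    and int: "\<And>x. x \<in> space S \<Longrightarrow> integrable (distr M T Y) (\<lambda>t. h (x, t))"
    and centered: "\<And>x. x \<in> space S \<Longrightarrow> (\<integral>t. h (x, t) \<partial>distr M T Y) = 0"
    and W: "W \<in> borel_measurable (past I)" "W \<in> L2 M"
  shows "(\<integral>\<omega>. inner (W \<omega>) (h (X \<omega>, Y \<omega>)) \<partial>M) = 0"
proof -
  have WX: "(\<lambda>\<omega>. (W \<omega>, X \<omega>)) \<in> measurable (past I) (borel \<Otimes>\<^sub>M S)"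
    using W(1) X by simp
  define k where "k = (\<lambda>p. inner (fst (fst p)) (h (snd (fst p), snd p)))"
  have k: "k \<in> borel_measurable ((borel \<Otimes>\<^sub>M S) \<Otimes>\<^sub>M T)"
    unfolding k_def using h(1) by measurable
  have "(\<integral>\<omega>. inner (W \<omega>) (h (X \<omega>, Y \<omega>)) \<partial>M)
      = (\<integral>\<omega>. (\<integral>t. inner (W \<omega>) (h (X \<omega>, t)) \<partial>distr M T Y) \<partial>M)"
    using integral_past_new[OF j WX k] L2_inner_integrable[OF W(2) h(2)] by (simp add: k_def)
  also have "\<dots> = (\<integral>\<omega>. 0 \<partial>M)"
    using int centered measurable_space[OF measurable_past[OF X]]
    by (intro Bochner_Integration.integral_cong) auto
  finally show ?thesis by simp
qed

end

subsection \<open>Local iterations and quantization in GenQSGD\<close>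

lemma Int_stable_vimage: "Int_stable {X -` A \<inter> \<Omega> | A. A \<in> sets S}"
proof (rule Int_stableI)
  fix a b
  assume "a \<in> {X -` A \<inter> \<Omega> | A. A \<in> sets S}" "b \<in> {X -` A \<inter> \<Omega> | A. A \<in> sets S}"
  then obtain A B where "A \<in> sets S" "B \<in> sets S" "a = X -` A \<inter> \<Omega>" "b = X -` B \<inter> \<Omega>"
    by auto
  then have "a \<inter> b = X -` (A \<inter> B) \<inter> \<Omega>" "A \<inter> B \<in> sets S"
    by auto
  then show "a \<inter> b \<in> {X -` A \<inter> \<Omega> | A. A \<in> sets S}"
    by blast
qed

lemma Int_stable_draw_events: "Int_stable (draw_events M Z U s \<xi> \<theta> d)"
  by (cases d) (auto simp: Int_stable_vimage)

text \<open>
  \<open>f\<close> stands for the common value of the losses of all workers (their data are identically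
  distributed), hence also for the global loss; \<open>g\<close> is its gradient.
\<close>

locale genqsgd = prob_space M for M :: "'w measure" +
  fixes Z :: "'z measure" and U :: "nat \<Rightarrow> 'u measure"
    and F :: "'a::euclidean_space \<Rightarrow> 'z \<Rightarrow> real"
    and Q :: "nat \<Rightarrow> 'u \<Rightarrow> 'a \<Rightarrow> 'a"
    and \<xi> :: "nat \<Rightarrow> nat \<Rightarrow> nat \<Rightarrow> nat \<Rightarrow> 'w \<Rightarrow> 'z"
    and \<theta> :: "nat \<Rightarrow> nat \<Rightarrow> 'w \<Rightarrow> 'u"
    and N B :: nat and K s :: "nat \<Rightarrow> nat" and \<gamma> q :: "nat \<Rightarrow> real"
    and L \<sigma> G fstar :: real and x1 :: 'a
    and f :: "'a \<Rightarrow> real" and g :: "'a \<Rightarrow> 'a"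
  assumes N_pos: "N \<ge> 1"
    and B_pos: "B \<ge> 1"
    and s_pos: "\<And>n. n \<in> {0..N} \<Longrightarrow> s n \<ge> 1"
    and grad_F_measurable: "(\<lambda>(x, z). grad (\<lambda>y. F y z) x) \<in> borel_measurable (borel \<Otimes>\<^sub>M Z)"
    and sample_measurable: "\<And>n k0 k b. Sample n k0 k b \<in> draws N K B \<Longrightarrow> \<xi> n k0 k b \<in> measurable M Z"
    and seed_measurable: "\<And>k0 n. Seed k0 n \<in> draws N K B \<Longrightarrow> \<theta> k0 n \<in> measurable M (U (s n))"
    and seed_distr: "\<And>k0 n. Seed k0 n \<in> draws N K B \<Longrightarrow> distr M (U (s n)) (\<theta> k0 n) = U (s n)"
    and independent_draws: "indep_sets (draw_events M Z U s \<xi> \<theta>) (draws N K B)"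
    and sample_grad_integrable: "\<And>n k0 k b x. Sample n k0 k b \<in> draws N K B \<Longrightarrow>
      integrable (distr M Z (\<xi> n k0 k b)) (\<lambda>z. grad (\<lambda>y. F y z) x)"
    and sample_grad_unbiased: "\<And>n k0 k b x. Sample n k0 k b \<in> draws N K B \<Longrightarrow>
      (\<integral>z. grad (\<lambda>y. F y z) x \<partial>distr M Z (\<xi> n k0 k b)) = g x"
    and variance_integrable: "\<And>n k0 k b x. Sample n k0 k b \<in> draws N K B \<Longrightarrow>
      integrable (distr M Z (\<xi> n k0 k b)) (\<lambda>z. (norm (grad (\<lambda>y. F y z) x - g x))\<^sup>2)"
    and variance_bound: "\<And>n k0 k b x. Sample n k0 k b \<in> draws N K B \<Longrightarrow>
      (\<integral>z. (norm (grad (\<lambda>y. F y z) x - g x))\<^sup>2 \<partial>distr M Z (\<xi> n k0 k b)) \<le> \<sigma>\<^sup>2"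
    and second_moment_integrable: "\<And>n k0 k b x. Sample n k0 k b \<in> draws N K B \<Longrightarrow>
      integrable (distr M Z (\<xi> n k0 k b)) (\<lambda>z. (norm (grad (\<lambda>y. F y z) x))\<^sup>2)"
    and second_moment_bound: "\<And>n k0 k b x. Sample n k0 k b \<in> draws N K B \<Longrightarrow>
      (\<integral>z. (norm (grad (\<lambda>y. F y z) x))\<^sup>2 \<partial>distr M Z (\<xi> n k0 k b)) \<le> G\<^sup>2"
    and quant_measurable: "\<And>t. t \<ge> 1 \<Longrightarrow> (\<lambda>(u, y). Q t u y) \<in> borel_measurable (U t \<Otimes>\<^sub>M borel)"
    and q_pos: "\<And>t. t \<ge> 1 \<Longrightarrow> q t > 0"
    and quant_prob: "\<And>t. t \<ge> 1 \<Longrightarrow> prob_space (U t)"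
    and quant_integrable: "\<And>t y. t \<ge> 1 \<Longrightarrow> integrable (U t) (\<lambda>u. Q t u y)"
    and quant_unbiased: "\<And>t y. t \<ge> 1 \<Longrightarrow> (\<integral>u. Q t u y \<partial>U t) = y"
    and quant_error_integrable: "\<And>t y. t \<ge> 1 \<Longrightarrow> integrable (U t) (\<lambda>u. (norm (Q t u y - y))\<^sup>2)"
    and quant_error: "\<And>t y. t \<ge> 1 \<Longrightarrow> (\<integral>u. (norm (Q t u y - y))\<^sup>2 \<partial>U t) \<le> q t * (norm y)\<^sup>2"
    and L_pos: "L > 0"
    and step_size: "\<And>k0. k0 \<in> {1..K 0} \<Longrightarrow> \<gamma> k0 \<in> {0<..1 / L}"
    and gradient: "\<And>x. GDERIV f x :> g x"
    and Lipschitz: "\<And>x y. norm (g x - g y) \<le> L * norm (x - y)"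
    and lower: "\<And>x. fstar \<le> f x"
begin

sublocale indep_events M "draw_events M Z U s \<xi> \<theta>" "draws N K B"
  by unfold_locales (auto simp: independent_draws Int_stable_draw_events)

abbreviation H :: "'a \<Rightarrow> 'z \<Rightarrow> 'a" where
  "H x z \<equiv> grad (\<lambda>y. F y z) x"

text \<open>
  \<open>X k0\<close>, \<open>Y n k0 k\<close> and \<open>V k0 k\<close> are the global model, the padded local model and the mean
  model; \<open>batch_grad n k0 k\<close> and \<open>noise n k0 k b\<close> belong to the step from \<open>k\<close> to \<open>Suc k\<close>, hence use
  the samples of local iteration \<open>Suc k\<close>.
\<close>

definition X :: "nat \<Rightarrow> 'w \<Rightarrow> 'a" where
  "X k0 \<omega> = global_model F Q N K B s \<gamma> x1 (\<lambda>n i j b. \<xi> n i j b \<omega>) (\<lambda>i n. \<theta> i n \<omega>) k0"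

definition Y :: "nat \<Rightarrow> nat \<Rightarrow> nat \<Rightarrow> 'w \<Rightarrow> 'a" where
  "Y n k0 k \<omega> = padded_worker_model F Q N K B s \<gamma> x1 (\<lambda>n i j b. \<xi> n i j b \<omega>) (\<lambda>i n. \<theta> i n \<omega>) n k0 k"

definition V :: "nat \<Rightarrow> nat \<Rightarrow> 'w \<Rightarrow> 'a" where
  "V k0 k \<omega> = mean_model F Q N K B s \<gamma> x1 (\<lambda>n i j b. \<xi> n i j b \<omega>) (\<lambda>i n. \<theta> i n \<omega>) k0 k"

definition batch_grad :: "nat \<Rightarrow> nat \<Rightarrow> nat \<Rightarrow> 'w \<Rightarrow> 'a" where
  "batch_grad n k0 k \<omega> = (1 / real B) *\<^sub>R (\<Sum>b=1..B. H (Y n k0 k \<omega>) (\<xi> n k0 (Suc k) b \<omega>))"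

definition noise :: "nat \<Rightarrow> nat \<Rightarrow> nat \<Rightarrow> nat \<Rightarrow> 'w \<Rightarrow> 'a" where
  "noise n k0 k b \<omega> = H (Y n k0 k \<omega>) (\<xi> n k0 (Suc k) b \<omega>) - g (Y n k0 k \<omega>)"

text \<open>All workers share one clock \<open>k\<close> of local iterations, since the mean model
  moves synchronously. Seeds of round \<open>k0\<close> are left out because quantization follows
  all local steps; \<open>hist (Suc k0) 0\<close> contains every draw of round
  \<open>k0\<close>.\<close>

definition hist :: "nat \<Rightarrow> nat \<Rightarrow> draw set" where
  "hist k0 k = {d. case d of Sample n i j b \<Rightarrow> i < k0 \<or> i = k0 \<and> j \<le> k | Seed i n \<Rightarrow> i < k0}"

definition active :: "nat \<Rightarrow> nat set" where
  "active k = {n\<in>{1..N}. k \<le> K n}"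

lemma finite_active: "finite (active k)"
  by (simp add: active_def)

lemma card_active: "card (active k) = active_workers N K k"
proof -
  have "active k = {1..N} \<inter> {n. k \<le> K n}"
    by (auto simp: active_def)
  then show ?thesis
    by (simp add: active_workers_def)
qed

lemma card_active_le: "card (active k) \<le> N"
  using card_mono[of "{1..N}" "active k"] by (simp add: active_def subset_eq)

lemma K_le_Kmax: "n \<in> {1..N} \<Longrightarrow> K n \<le> Kmax N K"
  unfolding Kmax_def by (intro Max_ge) auto

lemma X_1: "X 1 \<omega> = x1"
  by (simp add: X_def)

lemma X_Suc:
  assumes "k0 \<ge> 1"
  shows "X (Suc k0) \<omega> = X k0 \<omega> + \<gamma> k0 *\<^sub>R Q (s 0) (\<theta> k0 0 \<omega>)
    ((1 / real N) *\<^sub>R (\<Sum>n=1..N. Q (s n) (\<theta> k0 n \<omega>) ((1 / \<gamma> k0) *\<^sub>R (Y n k0 (K n) \<omega> - X k0 \<omega>))))"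
  using assms
  by (simp add: X_def Y_def padded_worker_model_def worker_model_def server_update_def Let_def)

lemma Y_0: "Y n k0 0 \<omega> = X k0 \<omega>"
  by (simp add: Y_def X_def padded_worker_model_def worker_model_def)

text \<open>A worker that has completed its \<open>K n\<close> steps stays put. The two branches of
  the padding agree at k = K n, which settles the boundary case.\<close>

lemma Y_Suc:
  "Y n k0 (Suc k) \<omega> = (if Suc k \<le> K n then Y n k0 k \<omega> - \<gamma> k0 *\<^sub>R batch_grad n k0 k \<omega> else Y n k0 k \<omega>)"
  by (auto simp: Y_def padded_worker_model_def worker_model_def batch_grad_def not_le le_Suc_eq
      dest: le_antisym)

lemma Y_Kmax: "n \<in> {1..N} \<Longrightarrow> Y n k0 (Kmax N K) \<omega> = Y n k0 (K n) \<omega>"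
  using K_le_Kmax[of n] by (auto simp: Y_def padded_worker_model_def)

text \<open>At k = 0 the mean model is defined as the global model; the average agrees with it
  because all workers start there.\<close>

lemma V_eq: "V k0 k \<omega> = (1 / real N) *\<^sub>R (\<Sum>n=1..N. Y n k0 k \<omega>)"
  using N_pos by (cases "k = 0")
    (simp_all add: V_def mean_model_def Y_0 flip: X_def Y_def, simp add: sum_constant_scaleR)

lemma V_0: "V k0 0 \<omega> = X k0 \<omega>"
  by (simp add: V_def X_def mean_model_def)

lemma sum_active: "(\<Sum>n\<in>active k. h n) = (\<Sum>n=1..N. if k \<le> K n then h n else 0)"
  unfolding active_def by (rule sum.inter_filter) simp

lemma batch_grad_eq:
  "batch_grad n k0 k \<omega> = g (Y n k0 k \<omega>) + (1 / real B) *\<^sub>R (\<Sum>b=1..B. noise n k0 k b \<omega>)"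
  using B_pos
  by (simp add: batch_grad_def noise_def sum_subtractf scaleR_diff_right sum_constant_scaleR)

text \<open>Only active workers move, yet the average still divides by \<open>N\<close>: this is the
  origin of the weight N_k/N. The noise is indexed by pairs of a worker and a sample so that all
  pairs can be treated as one orthogonal family.\<close>

lemma V_Suc:
  "V k0 (Suc k) \<omega> = V k0 k \<omega> - \<gamma> k0 *\<^sub>R ((1 / real N) *\<^sub>R (\<Sum>n\<in>active (Suc k). g (Y n k0 k \<omega>))
     + (1 / (real N * real B)) *\<^sub>R (\<Sum>(n, b)\<in>active (Suc k) \<times> {1..B}. noise n k0 k b \<omega>))"
proof -
  have "V k0 (Suc k) \<omega> = (1 / real N) *\<^sub>R (\<Sum>n=1..N. Y n k0 k \<omega>
      - (if Suc k \<le> K n then \<gamma> k0 *\<^sub>R batch_grad n k0 k \<omega> else 0))"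
    unfolding V_eq Y_Suc by (intro arg_cong2[where f = scaleR] sum.cong) auto
  also have "\<dots> = V k0 k \<omega> - (1 / real N) *\<^sub>R (\<Sum>n\<in>active (Suc k). \<gamma> k0 *\<^sub>R batch_grad n k0 k \<omega>)"
    by (simp only: V_eq sum_subtractf scaleR_diff_right sum_active)
  also have "\<dots> = V k0 k \<omega> - (1 / real N) *\<^sub>R (\<gamma> k0 *\<^sub>R (\<Sum>n\<in>active (Suc k). batch_grad n k0 k \<omega>))"
    by (simp only: scaleR_sum_right)
  finally show ?thesis
    by (simp add: batch_grad_eq sum.distrib scaleR_add_right scaleR_sum_right[symmetric]
        sum.cartesian_product[symmetric] mult.commute)
qed

section \<open>Samples and quantizer seeds applied to random models\<close>

lemma is_draw_sample:
  "Sample n k0 k b \<in> draws N K B \<Longrightarrow> is_draw (Sample n k0 k b) (\<xi> n k0 k b) Z"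
  using sample_measurable by (auto simp: is_draw_def)

lemma is_draw_seed: "Seed k0 n \<in> draws N K B \<Longrightarrow> is_draw (Seed k0 n) (\<theta> k0 n) (U (s n))"
  using seed_measurable by (auto simp: is_draw_def)

lemma hist_mono: "k \<le> k' \<Longrightarrow> hist k0 k \<subseteq> hist k0 k'"
  by (auto simp: hist_def split: draw.splits)

lemma g_measurable [measurable]: "g \<in> borel_measurable borel"
proof (intro borel_measurable_continuous_onI lipschitz_on_continuous_on)
  show "L-lipschitz_on UNIV g"
    using Lipschitz L_pos by (intro lipschitz_onI) (auto simp: dist_norm)
qed

lemma L2_g: "W \<in> L2 M \<Longrightarrow> (\<lambda>\<omega>. g (W \<omega>)) \<in> L2 M"
  using Lipschitz by (rule L2_Lipschitz)

lemma integrable_f: "W \<in> L2 M \<Longrightarrow> integrable M (\<lambda>\<omega>. f (W \<omega>))"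
  using gradient Lipschitz lower by (rule integrable_smooth)

lemma H_measurable_pair [measurable]: "(\<lambda>p. H (fst p) (snd p)) \<in> borel_measurable (borel \<Otimes>\<^sub>M Z)"
  using grad_F_measurable by (simp add: case_prod_beta)

text \<open>The moment hypotheses hold at every fixed model, hence also at a random model
  \<open>W\<close> that is determined by other draws: given the past, \<open>W\<close> acts as a
  constant.\<close>

lemma
  assumes S: "Sample n k0 k b \<in> draws N K B" and new: "Sample n k0 k b \<notin> I"
    and W: "W \<in> borel_measurable (past I)"
  shows sample_grad_L2: "(\<lambda>\<omega>. H (W \<omega>) (\<xi> n k0 k b \<omega>)) \<in> L2 M"
    and sample_grad_bound: "(\<integral>\<omega>. (norm (H (W \<omega>) (\<xi> n k0 k b \<omega>)))\<^sup>2 \<partial>M) \<le> G\<^sup>2"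
    and sample_noise_L2: "(\<lambda>\<omega>. H (W \<omega>) (\<xi> n k0 k b \<omega>) - g (W \<omega>)) \<in> L2 M"
    and sample_noise_bound: "(\<integral>\<omega>. (norm (H (W \<omega>) (\<xi> n k0 k b \<omega>) - g (W \<omega>)))\<^sup>2 \<partial>M) \<le> \<sigma>\<^sup>2"
proof -
  note d = is_draw_sample[OF S]
  show "(\<lambda>\<omega>. H (W \<omega>) (\<xi> n k0 k b \<omega>)) \<in> L2 M"
    by (rule L2_draw[OF d new W H_measurable_pair, where c = "\<lambda>_. G\<^sup>2", unfolded fst_conv snd_conv])
      (simp_all add: second_moment_integrable[OF S] second_moment_bound[OF S])
  show "(\<integral>\<omega>. (norm (H (W \<omega>) (\<xi> n k0 k b \<omega>)))\<^sup>2 \<partial>M) \<le> G\<^sup>2"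
    by (rule order_trans[OF integral_norm2_past_new[OF d new W H_measurable_pair,
            where c = "\<lambda>_. G\<^sup>2", unfolded fst_conv snd_conv]])
      (simp_all add: second_moment_integrable[OF S] second_moment_bound[OF S] prob_space)
  have m: "(\<lambda>p. H (fst p) (snd p) - g (fst p)) \<in> borel_measurable (borel \<Otimes>\<^sub>M Z)"
    by measurable
  show "(\<lambda>\<omega>. H (W \<omega>) (\<xi> n k0 k b \<omega>) - g (W \<omega>)) \<in> L2 M"
    by (rule L2_draw[OF d new W m, where c = "\<lambda>_. \<sigma>\<^sup>2", unfolded fst_conv snd_conv])
      (simp_all add: variance_integrable[OF S] variance_bound[OF S])
  show "(\<integral>\<omega>. (norm (H (W \<omega>) (\<xi> n k0 k b \<omega>) - g (W \<omega>)))\<^sup>2 \<partial>M) \<le> \<sigma>\<^sup>2"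
    by (rule order_trans[OF integral_norm2_past_new[OF d new W m,
            where c = "\<lambda>_. \<sigma>\<^sup>2", unfolded fst_conv snd_conv]])
      (simp_all add: variance_integrable[OF S] variance_bound[OF S] prob_space)
qed

lemma sample_noise_orthogonal:
  assumes S: "Sample n k0 k b \<in> draws N K B" and new: "Sample n k0 k b \<notin> I"
    and W: "W \<in> borel_measurable (past I)"
    and W': "W' \<in> borel_measurable (past I)" "W' \<in> L2 M"
  shows "(\<integral>\<omega>. inner (W' \<omega>) (H (W \<omega>) (\<xi> n k0 k b \<omega>) - g (W \<omega>)) \<partial>M) = 0"
proof -
  note d = is_draw_sample[OF S]
  interpret \<nu>: prob_space "distr M Z (\<xi> n k0 k b)"
    using sample_measurable[OF S] by (rule prob_space_distr)
  have \<nu>: "\<nu>.prob (space Z) = 1"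
    using \<nu>.prob_space by simp
  have m: "(\<lambda>p. H (fst p) (snd p) - g (fst p)) \<in> borel_measurable (borel \<Otimes>\<^sub>M Z)"
    by measurable
  show ?thesis
    by (rule integral_inner_draw[OF d new W m _ _ _ W', unfolded fst_conv snd_conv])
      (simp_all add: sample_noise_L2[OF S new W] sample_grad_integrable[OF S]
        sample_grad_unbiased[OF S] \<nu>)
qed

lemma
  assumes S: "Seed k0 n \<in> draws N K B" and new: "Seed k0 n \<notin> I"
    and W: "W \<in> borel_measurable (past I)" "W \<in> L2 M"
  shows quant_error_L2: "(\<lambda>\<omega>. Q (s n) (\<theta> k0 n \<omega>) (W \<omega>) - W \<omega>) \<in> L2 M"
    and quant_error_bound: "(\<integral>\<omega>. (norm (Q (s n) (\<theta> k0 n \<omega>) (W \<omega>) - W \<omega>))\<^sup>2 \<partial>M)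
      \<le> q (s n) * (\<integral>\<omega>. (norm (W \<omega>))\<^sup>2 \<partial>M)"
    and quant_error_orthogonal: "\<And>W'. W' \<in> borel_measurable (past I) \<Longrightarrow> W' \<in> L2 M \<Longrightarrow>
      (\<integral>\<omega>. inner (W' \<omega>) (Q (s n) (\<theta> k0 n \<omega>) (W \<omega>) - W \<omega>) \<partial>M) = 0"
proof -
  have sn: "s n \<ge> 1"
    using S s_pos[of n] by (auto simp: draws_def)
  interpret \<nu>: prob_space "U (s n)"
    using sn by (rule quant_prob)
  note d = is_draw_seed[OF S] and [measurable] = quant_measurable[OF sn]
  \<comment> \<open>\<open>quant_measurable\<close> puts the seed first, whereas the lemmas on new
    draws put the past first; hence the swap.\<close>
  have m: "(\<lambda>p. Q (s n) (snd p) (fst p) - fst p) \<in> borel_measurable (borel \<Otimes>\<^sub>M U (s n))"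
    using measurable_compose[OF measurable_pair_swap' quant_measurable[OF sn]]
    by (auto simp: case_prod_beta)
  have c: "integrable M (\<lambda>\<omega>. q (s n) * (norm (W \<omega>))\<^sup>2)"
    using W(2) by (simp add: L2_integrable)
  show L2: "(\<lambda>\<omega>. Q (s n) (\<theta> k0 n \<omega>) (W \<omega>) - W \<omega>) \<in> L2 M"
    by (rule L2_draw[OF d new W(1) m _ _ _ c, unfolded fst_conv snd_conv])
      (simp_all add: seed_distr[OF S] quant_error_integrable[OF sn] quant_error[OF sn])
  show "(\<integral>\<omega>. (norm (Q (s n) (\<theta> k0 n \<omega>) (W \<omega>) - W \<omega>))\<^sup>2 \<partial>M)
      \<le> q (s n) * (\<integral>\<omega>. (norm (W \<omega>))\<^sup>2 \<partial>M)"
    by (rule order_trans[OF integral_norm2_past_new[OF d new W(1) m _ _ _ c,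
            unfolded fst_conv snd_conv seed_distr[OF S]]])
      (simp_all add: quant_error_integrable[OF sn] quant_error[OF sn])
  show "(\<integral>\<omega>. inner (W' \<omega>) (Q (s n) (\<theta> k0 n \<omega>) (W \<omega>) - W \<omega>) \<partial>M) = 0"
    if W': "W' \<in> borel_measurable (past I)" "W' \<in> L2 M" for W'
    by (rule integral_inner_draw[OF d new W(1) m _ _ _ W', unfolded fst_conv snd_conv seed_distr[OF S]])
      (simp_all add: L2 quant_integrable[OF sn] quant_unbiased[OF sn] \<nu>.prob_space)
qed

end

text \<open>Polarisation of \<open>inner u (v i)\<close> yields the squared norm of each
  \<open>v i\<close> with the negative coefficient -c/(2N). Convexity, \<open>card I \<le> N\<close>
  and \<open>L * c \<le> 1\<close> bound the positive quadratic term in \<open>S\<close> by exactly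
  that amount, so the two cancel.\<close>

lemma inner_descent_le:
  fixes u :: "'a::real_inner" and v :: "'i \<Rightarrow> 'a"
  assumes I: "finite I" "real (card I) \<le> N" and c: "0 \<le> c" "L * c \<le> 1" and N: "0 < N"
  defines "S \<equiv> (1 / N) *\<^sub>R (\<Sum>i\<in>I. v i)"
  shows "- c * inner u S + L * c\<^sup>2 / 2 * (norm S)\<^sup>2
    \<le> - (c * real (card I) / (2 * N)) * (norm u)\<^sup>2 + c / (2 * N) * (\<Sum>i\<in>I. (norm (u - v i))\<^sup>2)"
proof -
  define T where "T = (\<Sum>i\<in>I. (norm (v i))\<^sup>2)"
  have polar: "(\<Sum>i\<in>I. (norm (u - v i))\<^sup>2) = real (card I) * (norm u)\<^sup>2 - 2 * N * inner u S + T"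
    using N by (simp add: S_def T_def power2_norm_eq_inner inner_simps inner_commute sum.distrib
        sum_subtractf inner_sum_right sum_distrib_left)
  have "(norm S)\<^sup>2 \<le> (1 / N\<^sup>2) * (real (card I) * T)"
    using norm_sum_power2_le[of v I] N
    by (simp add: S_def T_def power_mult_distrib power_divide divide_right_mono)
  also have "\<dots> \<le> (1 / N\<^sup>2) * (N * T)"
    using I by (intro mult_left_mono mult_right_mono) (auto simp: T_def intro!: sum_nonneg)
  finally have S: "(norm S)\<^sup>2 \<le> T / N"
    using N by (simp add: power2_eq_square)
  have "L * c\<^sup>2 / 2 * (norm S)\<^sup>2 = (L * c) * (c / 2 * (norm S)\<^sup>2)"
    by (simp add: power2_eq_square)
  also have "\<dots> \<le> c / 2 * (norm S)\<^sup>2"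
    using c mult_right_mono[of "L * c" 1 "c / 2 * (norm S)\<^sup>2"] by simp
  also have "\<dots> \<le> c / 2 * (T / N)"
    using S c by (intro mult_left_mono) auto
  finally show ?thesis
    unfolding polar using N by (simp add: field_simps)
qed

section \<open>One global iteration: local steps followed by quantization\<close>

context genqsgd
begin

lemma sample_in_draws:
  "k0 \<in> {1..K 0} \<Longrightarrow> n \<in> active (Suc k) \<Longrightarrow> b \<in> {1..B} \<Longrightarrow> Sample n k0 (Suc k) b \<in> draws N K B"
  by (auto simp: draws_def active_def)

lemma seed_in_draws: "k0 \<in> {1..K 0} \<Longrightarrow> n \<in> {0..N} \<Longrightarrow> Seed k0 n \<in> draws N K B"
  by (auto simp: draws_def)

text \<open>The assumptions on \<open>X k0\<close> are the induction hypothesis on the rounds;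
  \<open>server_step\<close> reproduces them for \<open>Suc k0\<close>.\<close>

context
  fixes k0 :: nat
  assumes k0: "k0 \<in> {1..K 0}"
    and X_adapted: "X k0 \<in> borel_measurable (past (hist k0 0))"
    and X_L2: "X k0 \<in> L2 M"
begin

lemma gamma_pos: "0 < \<gamma> k0" and L_gamma_le: "L * \<gamma> k0 \<le> 1"
  using step_size[OF k0] L_pos by (auto simp: field_simps)

lemma sample_new: "Sample n k0 (Suc k) b \<notin> hist k0 k"
  by (simp add: hist_def)

text \<open>Both properties need one induction: the next stochastic gradient is square integrable
  because its sample is new relative to the current model, which is known only from
  adaptedness.\<close>

lemma Y_adapted_L2: "n \<in> {1..N} \<Longrightarrow> Y n k0 k \<in> borel_measurable (past (hist k0 k)) \<and> Y n k0 k \<in> L2 M"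
proof (induction k)
  case 0
  have "Y n k0 0 = X k0"
    by (simp add: Y_0 fun_eq_iff)
  then show ?case
    using X_adapted X_L2 by simp
next
  case (Suc k)
  have mono: "Y n k0 k \<in> borel_measurable (past (hist k0 (Suc k)))"
    using Suc by (intro measurable_past_mono[OF _ hist_mono[of k "Suc k"]]) auto
  show ?case
  proof (cases "Suc k \<le> K n")
    case True
    then have n: "n \<in> active (Suc k)"
      using Suc.prems by (simp add: active_def)
    have eq: "Y n k0 (Suc k) = (\<lambda>\<omega>. Y n k0 k \<omega> - \<gamma> k0 *\<^sub>R (1 / real B) *\<^sub>R
        (\<Sum>b=1..B. H (Y n k0 k \<omega>) (\<xi> n k0 (Suc k) b \<omega>)))"
      using True by (simp add: fun_eq_iff Y_Suc batch_grad_def)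
    have meas: "(\<lambda>\<omega>. H (Y n k0 k \<omega>) (\<xi> n k0 (Suc k) b \<omega>)) \<in> borel_measurable (past (hist k0 (Suc k)))"
      if "b \<in> {1..B}" for b
    proof -
      have "\<xi> n k0 (Suc k) b \<in> measurable (past (hist k0 (Suc k))) Z"
        by (rule measurable_past_draw[OF is_draw_sample[OF sample_in_draws[OF k0 n that]]])
          (simp add: hist_def)
      then have "(\<lambda>\<omega>. (Y n k0 k \<omega>, \<xi> n k0 (Suc k) b \<omega>)) \<in> measurable (past (hist k0 (Suc k))) (borel \<Otimes>\<^sub>M Z)"
        using mono by simp
      from measurable_compose[OF this H_measurable_pair] show ?thesis
        by simp
    qed
    have L2: "(\<lambda>\<omega>. H (Y n k0 k \<omega>) (\<xi> n k0 (Suc k) b \<omega>)) \<in> L2 M" if "b \<in> {1..B}" for b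
      using Suc by (intro sample_grad_L2[OF sample_in_draws[OF k0 n that] sample_new]) auto
    show ?thesis
      unfolding eq using mono meas L2 Suc
      by (intro conjI borel_measurable_diff borel_measurable_scaleR borel_measurable_sum
          borel_measurable_const L2_diff L2_scaleR L2_sum) auto
  next
    case False
    then have "Y n k0 (Suc k) = Y n k0 k"
      by (simp add: fun_eq_iff Y_Suc)
    then show ?thesis
      using Suc mono by simp
  qed
qed

lemma Y_adapted: "n \<in> {1..N} \<Longrightarrow> Y n k0 k \<in> borel_measurable (past (hist k0 k))"
  and Y_L2: "n \<in> {1..N} \<Longrightarrow> Y n k0 k \<in> L2 M"
  using Y_adapted_L2 by auto

lemma V_adapted: "V k0 k \<in> borel_measurable (past (hist k0 k))"
  and V_L2: "V k0 k \<in> L2 M"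
proof -
  have "V k0 k = (\<lambda>\<omega>. (1 / real N) *\<^sub>R (\<Sum>n=1..N. Y n k0 k \<omega>))"
    by (simp add: fun_eq_iff V_eq)
  then show "V k0 k \<in> borel_measurable (past (hist k0 k))" "V k0 k \<in> L2 M"
    using Y_adapted Y_L2 by (auto intro!: L2_scaleR L2_sum)
qed

lemma batch_grad_L2_bound:
  assumes n: "n \<in> active (Suc k)"
  shows "batch_grad n k0 k \<in> L2 M \<and> (\<integral>\<omega>. (norm (batch_grad n k0 k \<omega>))\<^sup>2 \<partial>M) \<le> G\<^sup>2"
proof -
  have Y: "Y n k0 k \<in> borel_measurable (past (hist k0 k))"
    using n by (intro Y_adapted) (simp add: active_def)
  define S where "S = (\<lambda>\<omega>. \<Sum>b=1..B. H (Y n k0 k \<omega>) (\<xi> n k0 (Suc k) b \<omega>))"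
  have eq: "batch_grad n k0 k = (\<lambda>\<omega>. (1 / real B) *\<^sub>R S \<omega>)"
    by (simp add: fun_eq_iff batch_grad_def S_def)
  have L2: "(\<lambda>\<omega>. H (Y n k0 k \<omega>) (\<xi> n k0 (Suc k) b \<omega>)) \<in> L2 M"
    and le: "(\<integral>\<omega>. (norm (H (Y n k0 k \<omega>) (\<xi> n k0 (Suc k) b \<omega>)))\<^sup>2 \<partial>M) \<le> G\<^sup>2" if "b \<in> {1..B}" for b
    using sample_grad_L2[OF sample_in_draws[OF k0 n that] sample_new Y]
      sample_grad_bound[OF sample_in_draws[OF k0 n that] sample_new Y] by auto
  have "(\<integral>\<omega>. (norm (S \<omega>))\<^sup>2 \<partial>M) \<le> (real (card {1..B}))\<^sup>2 * G\<^sup>2"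
    unfolding S_def using L2 le by (rule integral_norm2_sum_le_square)
  then have "(1 / real B)\<^sup>2 * (\<integral>\<omega>. (norm (S \<omega>))\<^sup>2 \<partial>M) \<le> G\<^sup>2"
    using B_pos by (simp add: power_divide field_simps)
  moreover have "S \<in> L2 M"
    unfolding S_def using L2 by (rule L2_sum)
  ultimately show ?thesis
    unfolding eq integral_norm2_scaleR by (simp add: L2_scaleR)
qed

lemma Y_minus_X:
  "Y n k0 k \<omega> - X k0 \<omega> = (- \<gamma> k0) *\<^sub>R (\<Sum>j<min k (K n). batch_grad n k0 j \<omega>)"
proof (induction k)
  case (Suc k)
  show ?case
  proof (cases "Suc k \<le> K n")
    case True
    then show ?thesis
      using Suc by (simp add: Y_Suc min_def scaleR_add_right algebra_simps)
  next
    case False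
    then have "min (Suc k) (K n) = min k (K n)"
      by simp
    with False show ?thesis
      using Suc by (simp add: Y_Suc)
  qed
qed (simp add: Y_0)

text \<open>At most \<open>K n\<close> gradients with second moment at most G^2 are added. They need
  not be centred, so Cauchy-Schwarz gives the square of the number of steps.\<close>

lemma drift_bound:
  assumes n: "n \<in> {1..N}"
  shows "(\<integral>\<omega>. (norm (Y n k0 k \<omega> - X k0 \<omega>))\<^sup>2 \<partial>M) \<le> (\<gamma> k0)\<^sup>2 * ((real (K n))\<^sup>2 * G\<^sup>2)"
proof -
  have a: "n \<in> active (Suc j)" if "j \<in> {..<min k (K n)}" for j
    using n that by (simp add: active_def)
  have "(\<integral>\<omega>. (norm (Y n k0 k \<omega> - X k0 \<omega>))\<^sup>2 \<partial>M)
      = (\<gamma> k0)\<^sup>2 * (\<integral>\<omega>. (norm (\<Sum>j<min k (K n). batch_grad n k0 j \<omega>))\<^sup>2 \<partial>M)"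
    unfolding Y_minus_X integral_norm2_scaleR by simp
  also have "\<dots> \<le> (\<gamma> k0)\<^sup>2 * ((real (card {..<min k (K n)}))\<^sup>2 * G\<^sup>2)"
    using batch_grad_L2_bound[OF a]
    by (intro mult_left_mono integral_norm2_sum_le_square) auto
  also have "\<dots> \<le> (\<gamma> k0)\<^sup>2 * ((real (K n))\<^sup>2 * G\<^sup>2)"
    by (intro mult_left_mono mult_right_mono power_mono) auto
  finally show ?thesis .
qed

text \<open>The deviation is split at the start \<open>X k0\<close> of the round. Each half is at
  most \<open>D\<close>, the first being an average of drifts, and the factors 2 + 2 yield the
  constant 4 of c_2.\<close>

lemma worker_deviation_bound:
  assumes n: "n \<in> {1..N}"
  shows "(\<integral>\<omega>. (norm (V k0 k \<omega> - Y n k0 k \<omega>))\<^sup>2 \<partial>M) \<le> 4 * (\<gamma> k0)\<^sup>2 * (real (Kmax N K))\<^sup>2 * G\<^sup>2"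
proof -
  define D where "D = (\<gamma> k0)\<^sup>2 * ((real (Kmax N K))\<^sup>2 * G\<^sup>2)"
  have L2: "(\<lambda>\<omega>. Y m k0 k \<omega> - X k0 \<omega>) \<in> L2 M" if "m \<in> {1..N}" for m
    using Y_L2[OF that] X_L2 by (rule L2_diff)
  have le: "(\<integral>\<omega>. (norm (Y m k0 k \<omega> - X k0 \<omega>))\<^sup>2 \<partial>M) \<le> D" if "m \<in> {1..N}" for m
  proof -
    have "(\<gamma> k0)\<^sup>2 * ((real (K m))\<^sup>2 * G\<^sup>2) \<le> D"
      unfolding D_def using K_le_Kmax[OF that] by (intro mult_left_mono mult_right_mono power_mono) auto
    then show ?thesis
      using drift_bound[OF that, of k] by simp
  qed
  have V: "V k0 k \<omega> - X k0 \<omega> = (1 / real N) *\<^sub>R (\<Sum>m=1..N. Y m k0 k \<omega> - X k0 \<omega>)" for \<omega>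
    using N_pos by (simp add: V_eq sum_subtractf scaleR_diff_right sum_constant_scaleR)
  have "(\<integral>\<omega>. (norm (\<Sum>m=1..N. Y m k0 k \<omega> - X k0 \<omega>))\<^sup>2 \<partial>M) \<le> (real (card {1..N}))\<^sup>2 * D"
    using L2 le by (rule integral_norm2_sum_le_square)
  then have "(\<integral>\<omega>. (norm (V k0 k \<omega> - X k0 \<omega>))\<^sup>2 \<partial>M) \<le> D"
    unfolding V integral_norm2_scaleR using N_pos by (simp add: power_divide field_simps)
  moreover have "(\<integral>\<omega>. (norm (X k0 \<omega> - Y n k0 k \<omega>))\<^sup>2 \<partial>M) \<le> D"
    using le[OF n] by (simp add: norm_minus_commute)
  moreover have "(\<integral>\<omega>. (norm ((V k0 k \<omega> - X k0 \<omega>) + (X k0 \<omega> - Y n k0 k \<omega>)))\<^sup>2 \<partial>M)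
      \<le> 2 * (\<integral>\<omega>. (norm (V k0 k \<omega> - X k0 \<omega>))\<^sup>2 \<partial>M) + 2 * (\<integral>\<omega>. (norm (X k0 \<omega> - Y n k0 k \<omega>))\<^sup>2 \<partial>M)"
    using V_L2 X_L2 Y_L2[OF n] by (intro integral_norm2_add_le L2_diff)
  ultimately show ?thesis
    by (simp add: D_def)
qed

lemma noise_L2: "n \<in> active (Suc k) \<Longrightarrow> b \<in> {1..B} \<Longrightarrow> noise n k0 k b \<in> L2 M"
  and noise_bound: "n \<in> active (Suc k) \<Longrightarrow> b \<in> {1..B} \<Longrightarrow> (\<integral>\<omega>. (norm (noise n k0 k b \<omega>))\<^sup>2 \<partial>M) \<le> \<sigma>\<^sup>2"
proof -
  assume n: "n \<in> active (Suc k)" and b: "b \<in> {1..B}"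
  have Y: "Y n k0 k \<in> borel_measurable (past (hist k0 k))"
    using n by (intro Y_adapted) (simp add: active_def)
  note S = sample_in_draws[OF k0 n b]
  show "noise n k0 k b \<in> L2 M"
    using sample_noise_L2[OF S sample_new Y] by (simp add: noise_def[abs_def])
  show "(\<integral>\<omega>. (norm (noise n k0 k b \<omega>))\<^sup>2 \<partial>M) \<le> \<sigma>\<^sup>2"
    using sample_noise_bound[OF S sample_new Y] by (simp add: noise_def)
qed

text \<open>The set \<open>I\<close> may exceed the history, as long as it avoids the sample in
  question; this freedom serves the pairwise case below.\<close>

lemma noise_orthogonal:
  assumes n: "n \<in> active (Suc k)" and b: "b \<in> {1..B}"
    and I: "hist k0 k \<subseteq> I" "Sample n k0 (Suc k) b \<notin> I"
    and W: "W \<in> borel_measurable (past I)" "W \<in> L2 M"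
  shows "(\<integral>\<omega>. inner (W \<omega>) (noise n k0 k b \<omega>) \<partial>M) = 0"
proof -
  have Y: "Y n k0 k \<in> borel_measurable (past I)"
    using n by (intro measurable_past_mono[OF Y_adapted I(1)]) (simp add: active_def)
  show ?thesis
    unfolding noise_def by (rule sample_noise_orthogonal[OF sample_in_draws[OF k0 n b] I(2) Y W])
qed

text \<open>Neither of two samples of one local iteration precedes the other, so one is adjoined to
  the past by hand: its noise becomes measurable with respect to \<open>I\<close>, while the other
  sample is still new.\<close>

lemma noise_pairwise_orthogonal:
  assumes n: "n \<in> active (Suc k)" "b \<in> {1..B}" and n': "n' \<in> active (Suc k)" "b' \<in> {1..B}"
    and ne: "(n', b') \<noteq> (n, b)"
  shows "(\<integral>\<omega>. inner (noise n' k0 k b' \<omega>) (noise n k0 k b \<omega>) \<partial>M) = 0"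
proof (rule noise_orthogonal[OF n])
  define I where "I = insert (Sample n' k0 (Suc k) b') (hist k0 k)"
  show "hist k0 k \<subseteq> I"
    by (auto simp: I_def)
  show "Sample n k0 (Suc k) b \<notin> I"
    using ne sample_new by (auto simp: I_def)
  have Y: "Y n' k0 k \<in> borel_measurable (past I)"
    using n' by (intro measurable_past_mono[OF Y_adapted]) (auto simp: active_def I_def)
  have "\<xi> n' k0 (Suc k) b' \<in> measurable (past I) Z"
    by (rule measurable_past_draw[OF is_draw_sample[OF sample_in_draws[OF k0 n']]]) (simp add: I_def)
  then have "(\<lambda>\<omega>. (Y n' k0 k \<omega>, \<xi> n' k0 (Suc k) b' \<omega>)) \<in> measurable (past I) (borel \<Otimes>\<^sub>M Z)"
    using Y by simp
  from measurable_compose[OF this H_measurable_pair]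
  show "noise n' k0 k b' \<in> borel_measurable (past I)"
    unfolding noise_def[abs_def] using measurable_compose[OF Y g_measurable] by simp
  show "noise n' k0 k b' \<in> L2 M"
    using n' by (rule noise_L2)
qed

text \<open>The displacement is -c times an adapted part \<open>S\<close> plus a centred part
  \<open>e\<close>. Both cross terms with \<open>e\<close> vanish in expectation since the gradient
  at the mean and \<open>S\<close> are functions of the past; only the squared norm of
  \<open>e\<close> survives.\<close>

lemma local_descent:
  "(\<integral>\<omega>. f (V k0 (Suc k) \<omega>) \<partial>M) \<le> (\<integral>\<omega>. f (V k0 k \<omega>) \<partial>M)
     - \<gamma> k0 * real (active_workers N K (Suc k)) / (2 * real N) * (\<integral>\<omega>. (norm (g (V k0 k \<omega>)))\<^sup>2 \<partial>M)
     + real (active_workers N K (Suc k)) / (2 * real N) *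
         (4 * L\<^sup>2 * G\<^sup>2 * (real (Kmax N K))\<^sup>2 * \<gamma> k0 ^ 3 + L * \<sigma>\<^sup>2 / (real N * real B) * (\<gamma> k0)\<^sup>2)"
proof -
  define A where "A = active (Suc k)"
  define a where "a = real (card A)"
  define S where "S = (\<lambda>\<omega>. (1 / real N) *\<^sub>R (\<Sum>n\<in>A. g (Y n k0 k \<omega>)))"
  define E where "E = (\<lambda>\<omega>. \<Sum>(n, b)\<in>A \<times> {1..B}. noise n k0 k b \<omega>)"
  define e where "e = (\<lambda>\<omega>. (1 / (real N * real B)) *\<^sub>R E \<omega>)"
  define c where "c = \<gamma> k0"
  have c: "0 < c" "L * c \<le> 1"
    using gamma_pos L_gamma_le by (auto simp: c_def)
  have A: "n \<in> {1..N}" if "n \<in> A" for n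
    using that by (simp add: A_def active_def)
  have fin: "finite A"
    by (simp add: A_def finite_active)
  have gY: "(\<lambda>\<omega>. g (Y n k0 k \<omega>)) \<in> borel_measurable (past (hist k0 k))"
    "(\<lambda>\<omega>. g (Y n k0 k \<omega>)) \<in> L2 M" if "n \<in> A" for n
    using measurable_compose[OF Y_adapted[OF A[OF that]] g_measurable] L2_g[OF Y_L2[OF A[OF that]]] by auto
  have gV: "(\<lambda>\<omega>. g (V k0 k \<omega>)) \<in> borel_measurable (past (hist k0 k))"
    "(\<lambda>\<omega>. g (V k0 k \<omega>)) \<in> L2 M"
    using measurable_compose[OF V_adapted g_measurable] L2_g[OF V_L2] by auto
  have S: "S \<in> borel_measurable (past (hist k0 k))" "S \<in> L2 M"
    unfolding S_def using gY by (auto intro!: L2_scaleR L2_sum)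
  have noise: "(case p of (n, b) \<Rightarrow> noise n k0 k b) \<in> L2 M" if "p \<in> A \<times> {1..B}" for p
    using that noise_L2 by (auto simp: A_def)
  have E': "E = (\<lambda>\<omega>. \<Sum>p\<in>A \<times> {1..B}. (case p of (n, b) \<Rightarrow> noise n k0 k b) \<omega>)"
    by (simp add: E_def fun_eq_iff case_prod_beta)
  have E: "E \<in> L2 M"
    unfolding E' using noise by (rule L2_sum)
  have e: "e \<in> L2 M"
    unfolding e_def using E by (rule L2_scaleR)
  have orth: "(\<integral>\<omega>. inner (W \<omega>) (e \<omega>) \<partial>M) = 0"
    if W: "W \<in> borel_measurable (past (hist k0 k))" "W \<in> L2 M" for W
  proof -
    have "(\<integral>\<omega>. inner (W \<omega>) (E \<omega>) \<partial>M)
        = (\<Sum>p\<in>A \<times> {1..B}. \<integral>\<omega>. inner (W \<omega>) ((case p of (n, b) \<Rightarrow> noise n k0 k b) \<omega>) \<partial>M)"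
      unfolding E' using W(2) noise by (rule integral_inner_sum)
    also have "\<dots> = 0"
    proof (rule sum.neutral, safe)
      fix n b
      assume "n \<in> A" "b \<in> {1..B}"
      then show "(\<integral>\<omega>. inner (W \<omega>) (noise n k0 k b \<omega>) \<partial>M) = 0"
        using W by (intro noise_orthogonal[of _ _ _ "hist k0 k"] sample_new) (auto simp: A_def)
    qed
    finally show ?thesis
      by (simp add: e_def)
  qed
  have "(\<integral>\<omega>. (norm (E \<omega>))\<^sup>2 \<partial>M)
      = (\<Sum>p\<in>A \<times> {1..B}. \<integral>\<omega>. (norm ((case p of (n, b) \<Rightarrow> noise n k0 k b) \<omega>))\<^sup>2 \<partial>M)"
    unfolding E' using fin noise
    by (intro integral_norm2_sum_orthogonal) (auto simp: A_def intro!: noise_pairwise_orthogonal)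
  also have "\<dots> \<le> (\<Sum>p\<in>A \<times> {1..B}. \<sigma>\<^sup>2)"
    using noise_bound by (intro sum_mono) (auto simp: A_def)
  also have "\<dots> = a * real B * \<sigma>\<^sup>2"
    by (simp add: a_def card_cartesian_product)
  finally have E_le: "(\<integral>\<omega>. (norm (E \<omega>))\<^sup>2 \<partial>M) \<le> a * real B * \<sigma>\<^sup>2" .
  \<comment> \<open>Of the prefactor 1/(N B)^2, one B is used up by the number a B of orthogonal
    terms. What remains is the weight a/N times \<sigma>^2/(N B).\<close>
  have "(\<integral>\<omega>. (norm (e \<omega>))\<^sup>2 \<partial>M) = (1 / (real N * real B))\<^sup>2 * (\<integral>\<omega>. (norm (E \<omega>))\<^sup>2 \<partial>M)"
    unfolding e_def by (rule integral_norm2_scaleR)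
  also have "\<dots> \<le> (1 / (real N * real B))\<^sup>2 * (a * real B * \<sigma>\<^sup>2)"
    using E_le by (rule mult_left_mono) simp
  also have "\<dots> = a * \<sigma>\<^sup>2 / ((real N)\<^sup>2 * real B)"
    using B_pos by (simp add: power2_eq_square)
  finally have e_le: "(\<integral>\<omega>. (norm (e \<omega>))\<^sup>2 \<partial>M) \<le> a * \<sigma>\<^sup>2 / ((real N)\<^sup>2 * real B)" .
  \<comment> \<open>The bound of \<open>inner_descent_le\<close> with gradient differences replaced
    by model distances via the Lipschitz condition, ready for
    \<open>worker_deviation_bound\<close>.\<close>
  define R where "R = (\<lambda>\<omega>. - (c * a / (2 * real N)) * (norm (g (V k0 k \<omega>)))\<^sup>2
      + c / (2 * real N) * (\<Sum>n\<in>A. L\<^sup>2 * (norm (V k0 k \<omega> - Y n k0 k \<omega>))\<^sup>2))"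
  have pointwise: "f (V k0 (Suc k) \<omega>) \<le> f (V k0 k \<omega>) + R \<omega> - c * inner (g (V k0 k \<omega>)) (e \<omega>)
      + L * c\<^sup>2 * inner (S \<omega>) (e \<omega>) + L * c\<^sup>2 / 2 * (norm (e \<omega>))\<^sup>2" for \<omega>
  proof -
    have d: "V k0 (Suc k) \<omega> - V k0 k \<omega> = - (c *\<^sub>R (S \<omega> + e \<omega>))"
      by (simp add: V_Suc S_def e_def E_def A_def c_def)
    have "f (V k0 (Suc k) \<omega>) \<le> f (V k0 k \<omega>) + inner (g (V k0 k \<omega>)) (- (c *\<^sub>R (S \<omega> + e \<omega>)))
        + L / 2 * (norm (- (c *\<^sub>R (S \<omega> + e \<omega>))))\<^sup>2"
      using GDERIV_Lipschitz_upper_bound[OF gradient Lipschitz, of "V k0 (Suc k) \<omega>" "V k0 k \<omega>"]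
      unfolding d .
    also have "\<dots> = f (V k0 k \<omega>) + (- c * inner (g (V k0 k \<omega>)) (S \<omega>) + L * c\<^sup>2 / 2 * (norm (S \<omega>))\<^sup>2)
        - c * inner (g (V k0 k \<omega>)) (e \<omega>) + L * c\<^sup>2 * inner (S \<omega>) (e \<omega>) + L * c\<^sup>2 / 2 * (norm (e \<omega>))\<^sup>2"
    proof -
      have "(norm (- (c *\<^sub>R (S \<omega> + e \<omega>))))\<^sup>2 = c\<^sup>2 * (norm (S \<omega> + e \<omega>))\<^sup>2"
        by (simp add: power_mult_distrib)
      also have "(norm (S \<omega> + e \<omega>))\<^sup>2 = (norm (S \<omega>))\<^sup>2 + 2 * inner (S \<omega>) (e \<omega>) + (norm (e \<omega>))\<^sup>2"
        by (simp add: power2_norm_eq_inner inner_simps inner_commute)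
      finally show ?thesis
        by (simp add: inner_add_right algebra_simps)
    qed
    finally have 1: "f (V k0 (Suc k) \<omega>) \<le> \<dots>" .
    have "- c * inner (g (V k0 k \<omega>)) (S \<omega>) + L * c\<^sup>2 / 2 * (norm (S \<omega>))\<^sup>2
        \<le> - (c * a / (2 * real N)) * (norm (g (V k0 k \<omega>)))\<^sup>2
          + c / (2 * real N) * (\<Sum>n\<in>A. (norm (g (V k0 k \<omega>) - g (Y n k0 k \<omega>)))\<^sup>2)"
      unfolding S_def a_def using fin c N_pos card_active_le[of "Suc k"]
      by (intro inner_descent_le) (auto simp: A_def)
    also have "\<dots> \<le> R \<omega>"
    proof -
      have "(norm (g x - g y))\<^sup>2 \<le> L\<^sup>2 * (norm (x - y))\<^sup>2" for x y
        using power_mono[OF Lipschitz[of x y], of 2] by (simp add: power_mult_distrib)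
      then show ?thesis
        unfolding R_def using c by (intro add_left_mono mult_left_mono sum_mono) auto
    qed
    finally show ?thesis
      using 1 by linarith
  qed
  note int = integrable_f[OF V_L2] L2_integrable[OF gV(2)] L2_integrable[OF e]
    L2_inner_integrable[OF gV(2) e] L2_inner_integrable[OF S(2) e]
  have intD: "integrable M (\<lambda>\<omega>. (norm (V k0 k \<omega> - Y n k0 k \<omega>))\<^sup>2)" if "n \<in> A" for n
    using V_L2 Y_L2[OF A[OF that]] by (intro L2_integrable L2_diff)
  have intR: "integrable M R"
    unfolding R_def using int intD by auto
  have "(\<integral>\<omega>. f (V k0 (Suc k) \<omega>) \<partial>M) \<le> (\<integral>\<omega>. f (V k0 k \<omega>) + R \<omega> - c * inner (g (V k0 k \<omega>)) (e \<omega>)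
      + L * c\<^sup>2 * inner (S \<omega>) (e \<omega>) + L * c\<^sup>2 / 2 * (norm (e \<omega>))\<^sup>2 \<partial>M)"
    using int intR by (intro integral_mono pointwise) auto
  also have "\<dots> = (\<integral>\<omega>. f (V k0 k \<omega>) \<partial>M) + (\<integral>\<omega>. R \<omega> \<partial>M) + L * c\<^sup>2 / 2 * (\<integral>\<omega>. (norm (e \<omega>))\<^sup>2 \<partial>M)"
    using int intR orth[OF gV] orth[OF S] by simp
  finally have main: "(\<integral>\<omega>. f (V k0 (Suc k) \<omega>) \<partial>M) \<le> \<dots>" .
  define T where "T = (\<Sum>n\<in>A. L\<^sup>2 * (\<integral>\<omega>. (norm (V k0 k \<omega> - Y n k0 k \<omega>))\<^sup>2 \<partial>M))"
  have R_eq: "(\<integral>\<omega>. R \<omega> \<partial>M)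
      = - (c * a / (2 * real N)) * (\<integral>\<omega>. (norm (g (V k0 k \<omega>)))\<^sup>2 \<partial>M) + c / (2 * real N) * T"
    unfolding R_def T_def using int intD by (simp add: Bochner_Integration.integral_sum)
  have "T \<le> (\<Sum>n\<in>A. L\<^sup>2 * (4 * c\<^sup>2 * (real (Kmax N K))\<^sup>2 * G\<^sup>2))"
    unfolding T_def c_def using A by (intro sum_mono mult_left_mono worker_deviation_bound) auto
  then have "c / (2 * real N) * T \<le> c / (2 * real N) * (a * (L\<^sup>2 * (4 * c\<^sup>2 * (real (Kmax N K))\<^sup>2 * G\<^sup>2)))"
    using c by (intro mult_left_mono) (auto simp: a_def)
  with R_eq have R_le: "(\<integral>\<omega>. R \<omega> \<partial>M) \<le> - (c * a / (2 * real N)) * (\<integral>\<omega>. (norm (g (V k0 k \<omega>)))\<^sup>2 \<partial>M)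
      + c / (2 * real N) * (a * (L\<^sup>2 * (4 * c\<^sup>2 * (real (Kmax N K))\<^sup>2 * G\<^sup>2)))"
    by linarith
  have "L * c\<^sup>2 / 2 * (\<integral>\<omega>. (norm (e \<omega>))\<^sup>2 \<partial>M) \<le> L * c\<^sup>2 / 2 * (a * \<sigma>\<^sup>2 / ((real N)\<^sup>2 * real B))"
    using L_pos by (intro mult_left_mono e_le) auto
  with main R_le have "(\<integral>\<omega>. f (V k0 (Suc k) \<omega>) \<partial>M) \<le> (\<integral>\<omega>. f (V k0 k \<omega>) \<partial>M)
      - (c * a / (2 * real N)) * (\<integral>\<omega>. (norm (g (V k0 k \<omega>)))\<^sup>2 \<partial>M)
      + c / (2 * real N) * (a * (L\<^sup>2 * (4 * c\<^sup>2 * (real (Kmax N K))\<^sup>2 * G\<^sup>2)))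
      + L * c\<^sup>2 / 2 * (a * \<sigma>\<^sup>2 / ((real N)\<^sup>2 * real B))"
    by linarith
  also have "\<dots> = (\<integral>\<omega>. f (V k0 k \<omega>) \<partial>M)
      - c * a / (2 * real N) * (\<integral>\<omega>. (norm (g (V k0 k \<omega>)))\<^sup>2 \<partial>M)
      + a / (2 * real N) * (4 * L\<^sup>2 * G\<^sup>2 * (real (Kmax N K))\<^sup>2 * c ^ 3 + L * \<sigma>\<^sup>2 / (real N * real B) * c\<^sup>2)"
    using N_pos B_pos by (simp add: field_simps power2_eq_square power3_eq_cube)
  finally show ?thesis
    unfolding a_def A_def c_def card_active .
qed

text \<open>Doubling clears the factor 1/2 of \<open>local_descent\<close>. Iteration k departs from
  the mean model of index k - 1, whence the shift.\<close>

lemma local_descent_sum: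
  "2 * (\<integral>\<omega>. f (V k0 m \<omega>) \<partial>M)
     + \<gamma> k0 * (\<Sum>k=1..m. real (active_workers N K k) / real N * (\<integral>\<omega>. (norm (g (V k0 (k - 1) \<omega>)))\<^sup>2 \<partial>M))
   \<le> 2 * (\<integral>\<omega>. f (X k0 \<omega>) \<partial>M) + (\<Sum>k=1..m. real (active_workers N K k)) / real N *
       (4 * L\<^sup>2 * G\<^sup>2 * (real (Kmax N K))\<^sup>2 * \<gamma> k0 ^ 3 + L * \<sigma>\<^sup>2 / (real N * real B) * (\<gamma> k0)\<^sup>2)"
proof (induction m)
  case (Suc m)
  define C where "C = 4 * L\<^sup>2 * G\<^sup>2 * (real (Kmax N K))\<^sup>2 * \<gamma> k0 ^ 3 + L * \<sigma>\<^sup>2 / (real N * real B) * (\<gamma> k0)\<^sup>2"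
  define P where "P = real (active_workers N K (Suc m)) / real N"
  have "2 * (\<integral>\<omega>. f (V k0 (Suc m) \<omega>) \<partial>M) \<le> 2 * ((\<integral>\<omega>. f (V k0 m \<omega>) \<partial>M)
      - \<gamma> k0 * P / 2 * (\<integral>\<omega>. (norm (g (V k0 m \<omega>)))\<^sup>2 \<partial>M) + P / 2 * C)"
    using local_descent[of m] by (intro mult_left_mono) (simp_all add: C_def P_def mult.commute[of 2])
  with Suc.IH show ?case
    unfolding C_def[symmetric] by (simp add: P_def mult.assoc add_divide_distrib distrib_left distrib_right)
qed (simp add: V_0)

text \<open>
  The server quantizes an average of quantized updates, so the total error splits into a server
  part and an average of worker parts, both centred given what precedes their seeds.
\<close>

lemma server_step:
  shows "X (Suc k0) \<in> borel_measurable (past (hist (Suc k0) 0))"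
    and "X (Suc k0) \<in> L2 M"
    and "2 * (\<integral>\<omega>. f (X (Suc k0) \<omega>) \<partial>M) \<le> 2 * (\<integral>\<omega>. f (V k0 (Kmax N K) \<omega>) \<partial>M)
      + L * G\<^sup>2 * (\<gamma> k0)\<^sup>2 / real N *
        (\<Sum>n=1..N. (q (s 0) + q (s n) + q (s 0) * q (s n)) * (real (K n))\<^sup>2)"
proof -
  define c where "c = \<gamma> k0"
  define I where "I = hist k0 (Kmax N K)"
  \<comment> \<open>The vector quantized by the server depends on the worker seeds, so the server
    error is centred only relative to this larger past; the worker errors are centred relative to
    \<open>I\<close>.\<close>
  define J where "J = I \<union> {Seed k0 n | n. n \<in> {1..N}}"
  \<comment> \<open>Dividing by the step size cancels the factor in the drift bound: the second
    moment of \<open>v n\<close> is bounded by K_n^2 G^2 without \<gamma>.\<close>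
  define v where "v = (\<lambda>n \<omega>. (1 / c) *\<^sub>R (Y n k0 (K n) \<omega> - X k0 \<omega>))"
  define r where "r = (\<lambda>n \<omega>. Q (s n) (\<theta> k0 n \<omega>) (v n \<omega>) - v n \<omega>)"
  define D where "D = (\<lambda>\<omega>. (1 / real N) *\<^sub>R (\<Sum>n=1..N. Q (s n) (\<theta> k0 n \<omega>) (v n \<omega>)))"
  define r0 where "r0 = (\<lambda>\<omega>. Q (s 0) (\<theta> k0 0 \<omega>) (D \<omega>) - D \<omega>)"
  define rs where "rs = (\<lambda>\<omega>. (1 / real N) *\<^sub>R (\<Sum>n=1..N. r n \<omega>))"
  define w where "w = (\<lambda>n. \<integral>\<omega>. (norm (v n \<omega>))\<^sup>2 \<partial>M)"
  have c: "0 < c"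
    using gamma_pos by (simp add: c_def)
  have IJ: "I \<subseteq> J" and JH: "J \<subseteq> hist (Suc k0) 0"
    by (auto simp: J_def I_def hist_def split: draw.splits)
  have seed_I: "Seed k0 n \<notin> I" for n
    by (simp add: I_def hist_def)
  have seed_J: "Seed k0 0 \<notin> J"
    using seed_I by (auto simp: J_def)
  have sn: "s n \<ge> 1" if "n \<in> {0..N}" for n
    using that by (rule s_pos)
  have Q_meas: "(\<lambda>\<omega>. Q (s n) (\<theta> k0 n \<omega>) (W \<omega>)) \<in> borel_measurable (past A)"
    if "n \<in> {0..N}" "Seed k0 n \<in> A" "W \<in> borel_measurable (past A)" for n W A
  proof -
    have "\<theta> k0 n \<in> measurable (past A) (U (s n))"
      using that by (intro measurable_past_draw[OF is_draw_seed[OF seed_in_draws[OF k0]]])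
    then have "(\<lambda>\<omega>. (\<theta> k0 n \<omega>, W \<omega>)) \<in> measurable (past A) (U (s n) \<Otimes>\<^sub>M borel)"
      using that by simp
    from measurable_compose[OF this quant_measurable[OF sn[OF that(1)]]] show ?thesis
      by simp
  qed
  have X_I: "X k0 \<in> borel_measurable (past I)"
    unfolding I_def by (rule measurable_past_mono[OF X_adapted hist_mono]) simp
  have v: "v n \<in> borel_measurable (past I)" "v n \<in> L2 M" "w n \<le> (real (K n))\<^sup>2 * G\<^sup>2"
    if n: "n \<in> {1..N}" for n
  proof -
    have "Y n k0 (K n) \<in> borel_measurable (past I)"
      unfolding I_def by (rule measurable_past_mono[OF Y_adapted[OF n] hist_mono[OF K_le_Kmax[OF n]]])
    then show "v n \<in> borel_measurable (past I)"
      unfolding v_def using X_I by simp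
    show "v n \<in> L2 M"
      unfolding v_def using Y_L2[OF n] X_L2 by (intro L2_scaleR L2_diff)
    have "w n = (1 / c)\<^sup>2 * (\<integral>\<omega>. (norm (Y n k0 (K n) \<omega> - X k0 \<omega>))\<^sup>2 \<partial>M)"
      unfolding w_def v_def by (rule integral_norm2_scaleR)
    also have "\<dots> \<le> (1 / c)\<^sup>2 * (c\<^sup>2 * ((real (K n))\<^sup>2 * G\<^sup>2))"
      unfolding c_def by (intro mult_left_mono drift_bound[OF n]) simp
    finally show "w n \<le> (real (K n))\<^sup>2 * G\<^sup>2"
      using c by (simp add: power_divide)
  qed
  have r: "r n \<in> L2 M" "(\<integral>\<omega>. (norm (r n \<omega>))\<^sup>2 \<partial>M) \<le> q (s n) * w n"
    "\<And>W. W \<in> borel_measurable (past I) \<Longrightarrow> W \<in> L2 M \<Longrightarrow> (\<integral>\<omega>. inner (W \<omega>) (r n \<omega>) \<partial>M) = 0"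
    if n: "n \<in> {1..N}" for n
  proof -
    have S: "Seed k0 n \<in> draws N K B"
      using n by (intro seed_in_draws[OF k0]) auto
    note * = S seed_I v(1,2)[OF n]
    show "r n \<in> L2 M" "(\<integral>\<omega>. (norm (r n \<omega>))\<^sup>2 \<partial>M) \<le> q (s n) * w n"
      "\<And>W. W \<in> borel_measurable (past I) \<Longrightarrow> W \<in> L2 M \<Longrightarrow> (\<integral>\<omega>. inner (W \<omega>) (r n \<omega>) \<partial>M) = 0"
      unfolding r_def w_def
      using quant_error_L2[OF *] quant_error_bound[OF *] quant_error_orthogonal[OF *] by auto
  qed
  have Qv: "(\<lambda>\<omega>. Q (s n) (\<theta> k0 n \<omega>) (v n \<omega>)) \<in> borel_measurable (past J)"
    "(\<lambda>\<omega>. Q (s n) (\<theta> k0 n \<omega>) (v n \<omega>)) \<in> L2 M"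
    "(\<integral>\<omega>. (norm (Q (s n) (\<theta> k0 n \<omega>) (v n \<omega>)))\<^sup>2 \<partial>M) \<le> (1 + q (s n)) * w n"
    if n: "n \<in> {1..N}" for n
  proof -
    show "(\<lambda>\<omega>. Q (s n) (\<theta> k0 n \<omega>) (v n \<omega>)) \<in> borel_measurable (past J)"
      using n measurable_past_mono[OF v(1)[OF n] IJ] by (intro Q_meas) (auto simp: J_def)
    have eq: "Q (s n) (\<theta> k0 n \<omega>) (v n \<omega>) = v n \<omega> + r n \<omega>" for \<omega>
      by (simp add: r_def)
    show "(\<lambda>\<omega>. Q (s n) (\<theta> k0 n \<omega>) (v n \<omega>)) \<in> L2 M"
      unfolding eq using v(2)[OF n] r(1)[OF n] by (rule L2_add)
    \<comment> \<open>Pythagoras: the quantization error is orthogonal to its own input, which is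
      measurable with respect to \<open>I\<close>.\<close>
    show "(\<integral>\<omega>. (norm (Q (s n) (\<theta> k0 n \<omega>) (v n \<omega>)))\<^sup>2 \<partial>M) \<le> (1 + q (s n)) * w n"
      unfolding eq integral_norm2_add[OF v(2)[OF n] r(1)[OF n]]
      using r(2)[OF n] r(3)[OF n v(1,2)[OF n]] by (simp add: w_def distrib_right)
  qed
  have average: "(\<integral>\<omega>. (norm ((1 / real N) *\<^sub>R (\<Sum>n=1..N. W n \<omega>)))\<^sup>2 \<partial>M) \<le> (1 / real N) * (\<Sum>n=1..N. b n)"
    if "\<And>n. n \<in> {1..N} \<Longrightarrow> W n \<in> L2 M"
      "\<And>n. n \<in> {1..N} \<Longrightarrow> (\<integral>\<omega>. (norm (W n \<omega>))\<^sup>2 \<partial>M) \<le> b n"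
    for W :: "nat \<Rightarrow> 'w \<Rightarrow> 'a" and b
  proof -
    have "(\<integral>\<omega>. (norm (\<Sum>n=1..N. W n \<omega>))\<^sup>2 \<partial>M) \<le> real (card {1..N}) * (\<Sum>n=1..N. \<integral>\<omega>. (norm (W n \<omega>))\<^sup>2 \<partial>M)"
      using that(1) by (rule integral_norm2_sum_le)
    also have "\<dots> \<le> real (card {1..N}) * (\<Sum>n=1..N. b n)"
      using that(2) by (intro mult_left_mono sum_mono) auto
    finally have "(1 / real N)\<^sup>2 * (\<integral>\<omega>. (norm (\<Sum>n=1..N. W n \<omega>))\<^sup>2 \<partial>M)
        \<le> (1 / real N)\<^sup>2 * (real N * (\<Sum>n=1..N. b n))"
      by (intro mult_left_mono) auto
    then show ?thesis
      unfolding integral_norm2_scaleR using N_pos by (simp add: power2_eq_square)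
  qed
  have D: "D \<in> borel_measurable (past J)" "D \<in> L2 M"
    unfolding D_def using Qv by (auto intro!: L2_scaleR L2_sum)
  have D_le: "(\<integral>\<omega>. (norm (D \<omega>))\<^sup>2 \<partial>M) \<le> (1 / real N) * (\<Sum>n=1..N. (1 + q (s n)) * w n)"
    unfolding D_def using Qv(2,3) by (rule average)
  have rs: "rs \<in> borel_measurable (past J)" "rs \<in> L2 M"
  proof -
    have "v n \<in> borel_measurable (past J)" if "n \<in> {1..N}" for n
      using v(1)[OF that] IJ by (rule measurable_past_mono)
    then show "rs \<in> borel_measurable (past J)"
      unfolding rs_def r_def using Qv(1) by auto
    show "rs \<in> L2 M"
      unfolding rs_def using r by (intro L2_scaleR L2_sum)
  qed
  have rs_le: "(\<integral>\<omega>. (norm (rs \<omega>))\<^sup>2 \<partial>M) \<le> (1 / real N) * (\<Sum>n=1..N. q (s n) * w n)"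
    unfolding rs_def using r(1,2) by (rule average)
  have S0: "Seed k0 0 \<in> draws N K B"
    by (intro seed_in_draws[OF k0]) auto
  note * = S0 seed_J D
  have r0: "r0 \<in> L2 M" "(\<integral>\<omega>. (norm (r0 \<omega>))\<^sup>2 \<partial>M) \<le> q (s 0) * (\<integral>\<omega>. (norm (D \<omega>))\<^sup>2 \<partial>M)"
    "\<And>W. W \<in> borel_measurable (past J) \<Longrightarrow> W \<in> L2 M \<Longrightarrow> (\<integral>\<omega>. inner (W \<omega>) (r0 \<omega>) \<partial>M) = 0"
    unfolding r0_def using quant_error_L2[OF *] quant_error_bound[OF *] quant_error_orthogonal[OF *]
    by auto
  have X': "X (Suc k0) \<omega> = X k0 \<omega> + c *\<^sub>R Q (s 0) (\<theta> k0 0 \<omega>) (D \<omega>)" for \<omega>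
    using k0 by (simp add: X_Suc D_def v_def c_def)
  have "(\<lambda>\<omega>. Q (s 0) (\<theta> k0 0 \<omega>) (D \<omega>)) \<in> borel_measurable (past (hist (Suc k0) 0))"
    using measurable_past_mono[OF D(1) JH] by (intro Q_meas) (auto simp: hist_def)
  moreover have "X k0 \<in> borel_measurable (past (hist (Suc k0) 0))"
    using X_I by (rule measurable_past_mono) (use IJ JH in auto)
  ultimately show "X (Suc k0) \<in> borel_measurable (past (hist (Suc k0) 0))"
    unfolding X'[abs_def] by simp
  define V' where "V' = V k0 (Kmax N K)"
  have V': "V' \<in> borel_measurable (past I)" "V' \<in> L2 M"
    unfolding V'_def I_def by (rule V_adapted V_L2)+
  \<comment> \<open>\<open>V'\<close> is the model the server would reach without quantization;
    padding lets the final iterates of all workers be read off at the common index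
    \<open>Kmax N K\<close>.\<close>
  have XV: "X (Suc k0) \<omega> = V' \<omega> + c *\<^sub>R (rs \<omega> + r0 \<omega>)" for \<omega>
  proof -
    have "V' \<omega> = (1 / real N) *\<^sub>R (\<Sum>n=1..N. Y n k0 (K n) \<omega>)"
      by (simp add: V'_def V_eq Y_Kmax)
    also have "\<dots> = (1 / real N) *\<^sub>R (\<Sum>n=1..N. X k0 \<omega> + c *\<^sub>R v n \<omega>)"
      using c by (simp add: v_def)
    also have "\<dots> = X k0 \<omega> + c *\<^sub>R ((1 / real N) *\<^sub>R (\<Sum>n=1..N. v n \<omega>))"
      using N_pos by (simp add: sum.distrib scaleR_add_right sum_constant_scaleR scaleR_sum_right[symmetric] mult.commute)
    also have "(1 / real N) *\<^sub>R (\<Sum>n=1..N. v n \<omega>) = D \<omega> - rs \<omega>"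
      by (simp add: D_def rs_def r_def sum_subtractf scaleR_diff_right)
    finally show ?thesis
      by (simp add: X' r0_def algebra_simps)
  qed
  have err: "(\<lambda>\<omega>. rs \<omega> + r0 \<omega>) \<in> L2 M"
    using rs(2) r0(1) by (rule L2_add)
  show X'_L2: "X (Suc k0) \<in> L2 M"
    unfolding XV[abs_def] by (rule L2_add[OF V'(2) L2_scaleR[OF err]])
  have gV: "(\<lambda>\<omega>. g (V' \<omega>)) \<in> borel_measurable (past I)" "(\<lambda>\<omega>. g (V' \<omega>)) \<in> L2 M"
    using measurable_compose[OF V'(1) g_measurable] L2_g[OF V'(2)] by auto
  have "(\<integral>\<omega>. inner (g (V' \<omega>)) (\<Sum>n=1..N. r n \<omega>) \<partial>M) = (\<Sum>n=1..N. \<integral>\<omega>. inner (g (V' \<omega>)) (r n \<omega>) \<partial>M)"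
    using gV(2) r(1) by (rule integral_inner_sum)
  then have "(\<integral>\<omega>. inner (g (V' \<omega>)) (rs \<omega>) \<partial>M) = 0"
    using r(3) gV by (simp add: rs_def)
  moreover have "(\<integral>\<omega>. inner (g (V' \<omega>)) (r0 \<omega>) \<partial>M) = 0"
    using r0(3) measurable_past_mono[OF gV(1) IJ] gV(2) by blast
  ultimately have orth: "(\<integral>\<omega>. inner (g (V' \<omega>)) (rs \<omega> + r0 \<omega>) \<partial>M) = 0"
    using L2_inner_integrable[OF gV(2) rs(2)] L2_inner_integrable[OF gV(2) r0(1)]
    by (simp add: inner_add_right)
  have pointwise: "f (X (Suc k0) \<omega>) \<le> f (V' \<omega>) + c * inner (g (V' \<omega>)) (rs \<omega> + r0 \<omega>)
      + L / 2 * c\<^sup>2 * (norm (rs \<omega> + r0 \<omega>))\<^sup>2" for \<omega>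
    using GDERIV_Lipschitz_upper_bound[OF gradient Lipschitz, of "X (Suc k0) \<omega>" "V' \<omega>"]
    by (simp add: XV power_mult_distrib)
  have "(\<integral>\<omega>. f (X (Suc k0) \<omega>) \<partial>M) \<le> (\<integral>\<omega>. f (V' \<omega>) + c * inner (g (V' \<omega>)) (rs \<omega> + r0 \<omega>)
      + L / 2 * c\<^sup>2 * (norm (rs \<omega> + r0 \<omega>))\<^sup>2 \<partial>M)"
    using integrable_f[OF X'_L2] integrable_f[OF V'(2)] L2_inner_integrable[OF gV(2) err] L2_integrable[OF err]
    by (intro integral_mono pointwise) auto
  also have "\<dots> = (\<integral>\<omega>. f (V' \<omega>) \<partial>M) + L / 2 * c\<^sup>2 * (\<integral>\<omega>. (norm (rs \<omega> + r0 \<omega>))\<^sup>2 \<partial>M)"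
    using integrable_f[OF V'(2)] L2_inner_integrable[OF gV(2) err] L2_integrable[OF err] orth by simp
  finally have main: "(\<integral>\<omega>. f (X (Suc k0) \<omega>) \<partial>M) \<le> \<dots>" .
  define p where "p = (\<lambda>n. q (s 0) + q (s n) + q (s 0) * q (s n))"
  have q0: "0 < q (s n)" if "n \<in> {0..N}" for n
    using q_pos[OF sn[OF that]] .
  \<comment> \<open>The worker error is measurable with respect to \<open>J\<close>, hence
    orthogonal to the server error. The weights combine to q_n + q_0 (1 + q_n), which is the
    q_{s_0,s_n} of the theorem.\<close>
  have "(\<integral>\<omega>. (norm (rs \<omega> + r0 \<omega>))\<^sup>2 \<partial>M) = (\<integral>\<omega>. (norm (rs \<omega>))\<^sup>2 \<partial>M) + (\<integral>\<omega>. (norm (r0 \<omega>))\<^sup>2 \<partial>M)"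
    using integral_norm2_add[OF rs(2) r0(1)] r0(3)[OF rs] by simp
  also have "\<dots> \<le> (1 / real N) * (\<Sum>n=1..N. q (s n) * w n)
      + q (s 0) * ((1 / real N) * (\<Sum>n=1..N. (1 + q (s n)) * w n))"
    using rs_le r0(2) mult_left_mono[OF D_le, of "q (s 0)"] q0[of 0] by simp
  also have "\<dots> = (1 / real N) * (\<Sum>n=1..N. p n * w n)"
    by (simp add: p_def sum_distrib_left sum.distrib[symmetric] algebra_simps)
  also have "\<dots> \<le> (1 / real N) * (\<Sum>n=1..N. p n * ((real (K n))\<^sup>2 * G\<^sup>2))"
  proof (intro mult_left_mono sum_mono)
    fix n assume n: "n \<in> {1..N}"
    then show "w n \<le> (real (K n))\<^sup>2 * G\<^sup>2"
      by (rule v(3))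
    show "0 \<le> p n"
      using q0[of 0] q0[of n] n by (simp add: p_def)
  qed simp
  finally have "L / 2 * c\<^sup>2 * (\<integral>\<omega>. (norm (rs \<omega> + r0 \<omega>))\<^sup>2 \<partial>M)
      \<le> L / 2 * c\<^sup>2 * ((1 / real N) * (\<Sum>n=1..N. p n * ((real (K n))\<^sup>2 * G\<^sup>2)))"
    using L_pos by (intro mult_left_mono) auto
  with main have "2 * (\<integral>\<omega>. f (X (Suc k0) \<omega>) \<partial>M) \<le> 2 * (\<integral>\<omega>. f (V' \<omega>) \<partial>M)
      + L * c\<^sup>2 * ((1 / real N) * (\<Sum>n=1..N. p n * ((real (K n))\<^sup>2 * G\<^sup>2)))"
    by simp
  also have "(\<Sum>n=1..N. p n * ((real (K n))\<^sup>2 * G\<^sup>2)) = G\<^sup>2 * (\<Sum>n=1..N. p n * (real (K n))\<^sup>2)"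
    by (simp add: sum_distrib_left algebra_simps)
  finally show "2 * (\<integral>\<omega>. f (X (Suc k0) \<omega>) \<partial>M) \<le> 2 * (\<integral>\<omega>. f (V k0 (Kmax N K) \<omega>) \<partial>M)
      + L * G\<^sup>2 * (\<gamma> k0)\<^sup>2 / real N *
        (\<Sum>n=1..N. (q (s 0) + q (s n) + q (s 0) * q (s n)) * (real (K n))\<^sup>2)"
    by (simp add: V'_def c_def p_def algebra_simps)
qed

end

subsection \<open>Telescoping over the global iterations\<close>

text \<open>The range includes \<open>Suc (K 0)\<close>, the model after the last server update, at
  which the telescoping sum ends.\<close>

lemma X_adapted_L2:
  assumes "1 \<le> k0" "k0 \<le> Suc (K 0)"
  shows "X k0 \<in> borel_measurable (past (hist k0 0)) \<and> X k0 \<in> L2 M"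
  using assms
proof (induction k0 rule: dec_induct)
  case base
  have "X 1 = (\<lambda>_. x1)"
    by (simp add: X_1 fun_eq_iff del: One_nat_def)
  then show ?case
    by (simp add: L2_const)
next
  case (step k0)
  then have "k0 \<in> {1..K 0}"
    by simp
  with step show ?case
    using server_step(1,2)[of k0] by simp
qed

text \<open>Double counting of the pairs of a worker and one of its local iterations.\<close>

lemma sum_active_workers: "(\<Sum>k=1..Kmax N K. real (active_workers N K k)) = (\<Sum>n=1..N. real (K n))"
proof -
  have "(\<Sum>k=1..Kmax N K. real (active_workers N K k))
      = (\<Sum>n=1..N. \<Sum>k=1..Kmax N K. of_bool (k \<le> K n))"
    unfolding active_workers_def of_nat_sum by (subst sum.swap) simp
  also have "\<dots> = (\<Sum>n=1..N. real (K n))"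
  proof (rule sum.cong[OF refl])
    fix n assume "n \<in> {1..N}"
    then have "{1..Kmax N K} \<inter> {k. k \<le> K n} = {1..K n}"
      using K_le_Kmax[of n] by auto
    then show "(\<Sum>k=1..Kmax N K. of_bool (k \<le> K n)) = real (K n)"
      by simp
  qed
  finally show ?thesis .
qed

lemma Max_K_square: "Max ((\<lambda>n. (K n)\<^sup>2) ` {1..N}) = (Kmax N K)\<^sup>2"
proof -
  have "(Max (K ` {1..N}))\<^sup>2 = Max ((\<lambda>m. m\<^sup>2) ` K ` {1..N})"
    using N_pos by (intro mono_Max_commute) (auto intro!: monoI power_mono)
  then show ?thesis
    by (simp add: Kmax_def image_image)
qed

definition weight_sum :: real where
  "weight_sum = (\<Sum>n=1..N. (q (s 0) + q (s n) + q (s 0) * q (s n)) * (real (K n))\<^sup>2)"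

text \<open>Error terms of the doubled inequality for one round: drift and gradient noise summed
  over all local steps, plus quantization.\<close>

definition round_error :: "nat \<Rightarrow> real" where
  "round_error k0 = (\<Sum>n=1..N. real (K n)) / real N *
     (4 * L\<^sup>2 * G\<^sup>2 * (real (Kmax N K))\<^sup>2 * \<gamma> k0 ^ 3 + L * \<sigma>\<^sup>2 / (real N * real B) * (\<gamma> k0)\<^sup>2)
     + L * G\<^sup>2 * (\<gamma> k0)\<^sup>2 / real N * weight_sum"

definition round_gradients :: "nat \<Rightarrow> real" where
  "round_gradients k0 = (\<Sum>k=1..Kmax N K. real (active_workers N K k) / real N *
     (\<integral>\<omega>. (norm (g (V k0 (k - 1) \<omega>)))\<^sup>2 \<partial>M))"

lemma round_descent:
  assumes "k0 \<in> {1..K 0}"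
  shows "2 * (\<integral>\<omega>. f (X (Suc k0) \<omega>) \<partial>M) + \<gamma> k0 * round_gradients k0
    \<le> 2 * (\<integral>\<omega>. f (X k0 \<omega>) \<partial>M) + round_error k0"
proof -
  have X: "X k0 \<in> borel_measurable (past (hist k0 0))" "X k0 \<in> L2 M"
    using X_adapted_L2[of k0] assms by auto
  show ?thesis
    using server_step(3)[OF assms X] local_descent_sum[OF assms X, of "Kmax N K"]
    unfolding sum_active_workers round_error_def round_gradients_def weight_sum_def by linarith
qed

lemma total_descent:
  assumes "m \<le> K 0"
  shows "2 * (\<integral>\<omega>. f (X (Suc m) \<omega>) \<partial>M) + (\<Sum>k0=1..m. \<gamma> k0 * round_gradients k0)
    \<le> 2 * f x1 + (\<Sum>k0=1..m. round_error k0)"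
  using assms
proof (induction m)
  case 0
  then show ?case
    using X_1 by (simp add: prob_space)
next
  case (Suc m)
  then show ?case
    using round_descent[of "Suc m"] by simp
qed

lemma integrable_gradient_norm2:
  assumes "k0 \<in> {1..K 0}"
  shows "integrable M (\<lambda>\<omega>. (norm (g (V k0 k \<omega>)))\<^sup>2)"
  using X_adapted_L2[of k0] assms by (intro L2_integrable L2_g V_L2) auto

lemma weight_sum_nonneg: "0 \<le> weight_sum"
  unfolding weight_sum_def
proof (rule sum_nonneg)
  fix n assume "n \<in> {1..N}"
  then show "0 \<le> (q (s 0) + q (s n) + q (s 0) * q (s n)) * (real (K n))\<^sup>2"
    using q_pos[OF s_pos[of 0]] q_pos[OF s_pos[of n]] by simp
qed

lemma average_gradient_bound:
  assumes K_pos: "\<And>n. n \<in> {0..N} \<Longrightarrow> K n \<ge> 1"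
  shows "(\<Sum>k0=1..K 0. \<gamma> k0 * round_gradients k0)
      / (\<Sum>k0=1..K 0. \<gamma> k0 * (\<Sum>k=1..Kmax N K. real (active_workers N K k) / real N))
    \<le> C_A N K B \<gamma> s q L \<sigma> G (f x1) fstar"
proof -
  define S where "S = (\<Sum>n=1..N. real (K n))"
  define \<Gamma> where "\<Gamma> = (\<Sum>k0=1..K 0. \<gamma> k0)"
  define \<Gamma>2 where "\<Gamma>2 = (\<Sum>k0=1..K 0. (\<gamma> k0)\<^sup>2)"
  define \<Gamma>3 where "\<Gamma>3 = (\<Sum>k0=1..K 0. \<gamma> k0 ^ 3)"
  define m where "m = (real (Kmax N K))\<^sup>2"
  define T where "T = (\<Sum>k0=1..K 0. \<gamma> k0 * round_gradients k0)"
  have S: "0 < S"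
    unfolding S_def using N_pos K_pos by (intro sum_pos) (auto simp: Suc_le_eq)
  have \<Gamma>: "0 < \<Gamma>"
    unfolding \<Gamma>_def using K_pos[of 0] step_size by (intro sum_pos) auto
  have \<Gamma>2: "0 \<le> \<Gamma>2"
    unfolding \<Gamma>2_def by (intro sum_nonneg) auto
  have N: "0 < real N" and B: "0 < real B"
    using N_pos B_pos by auto
  have denominator: "(\<Sum>k0=1..K 0. \<gamma> k0 * (\<Sum>k=1..Kmax N K. real (active_workers N K k) / real N))
      = \<Gamma> * (S / real N)"
    unfolding sum_divide_distrib[symmetric] sum_active_workers \<Gamma>_def S_def sum_distrib_right ..
  define d where "d = S / real N * (4 * L\<^sup>2 * G\<^sup>2 * m * \<Gamma>3 + L * \<sigma>\<^sup>2 / (real N * real B) * \<Gamma>2)"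
  define e where "e = L * G\<^sup>2 * \<Gamma>2 / real N * weight_sum"
  \<comment> \<open>The expected loss after the last round is the end of the telescope and is
    discarded through this lower bound.\<close>
  have "fstar \<le> (\<integral>\<omega>. f (X (Suc (K 0)) \<omega>) \<partial>M)"
    using X_adapted_L2[of "Suc (K 0)"] lower by (intro integral_ge_const integrable_f) auto
  then have "T \<le> 2 * (f x1 - fstar) + (\<Sum>k0=1..K 0. round_error k0)"
    using total_descent[of "K 0"] by (simp add: T_def)
  moreover have "(\<Sum>k0=1..K 0. round_error k0) = d + e"
    unfolding round_error_def d_def e_def \<Gamma>2_def \<Gamma>3_def S_def[symmetric] m_def[symmetric]
    by (simp add: sum.distrib sum_distrib_left sum_distrib_right sum_divide_distrib distrib_left
        add_divide_distrib)
  \<comment> \<open>Telescoping yields the quantization term once, whereas c_4 = 2 L G^2 corresponds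
    to 2 e; nonnegativity bridges the gap.\<close>
  moreover have "0 \<le> e"
    unfolding e_def using L_pos \<Gamma>2 weight_sum_nonneg by simp
  ultimately have T: "T \<le> 2 * (f x1 - fstar) + (d + 2 * e)"
    by linarith
  have C: "C_A N K B \<gamma> s q L \<sigma> G (f x1) fstar
      = 2 * real N * (f x1 - fstar) / (S * \<Gamma>) + 4 * G\<^sup>2 * L\<^sup>2 * m * \<Gamma>3 / \<Gamma>
        + L * \<sigma>\<^sup>2 / real N * \<Gamma>2 / (real B * \<Gamma>) + 2 * L * G\<^sup>2 * weight_sum * \<Gamma>2 / (S * \<Gamma>)"
    unfolding C_A_def Let_def Max_K_square S_def \<Gamma>_def \<Gamma>2_def \<Gamma>3_def m_def weight_sum_def by simp
  have "C_A N K B \<gamma> s q L \<sigma> G (f x1) fstar * (\<Gamma> * (S / real N)) = 2 * (f x1 - fstar) + (d + 2 * e)"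
    unfolding C d_def e_def using S \<Gamma> N B
    by (simp add: distrib_right distrib_left add_divide_distrib mult_ac)
  moreover have "0 < \<Gamma> * (S / real N)"
    using S \<Gamma> N by simp
  ultimately show ?thesis
    unfolding denominator T_def[symmetric] using T by (simp only: pos_divide_le_eq)
qed

end

text \<open>The integrability conjunct certifies that the integrals in the second one are genuine
  expectations rather than the default value 0.\<close>

theorem theorem1:
  fixes M :: "'w measure" and Z :: "'z measure" and U :: "nat \<Rightarrow> 'u measure"
    and F :: "real ^ 'd \<Rightarrow> 'z \<Rightarrow> real"
    and Q :: "nat \<Rightarrow> 'u \<Rightarrow> real ^ 'd \<Rightarrow> real ^ 'd"
    and \<zeta> :: "nat \<Rightarrow> 'w \<Rightarrow> 'z"
    and \<xi> :: "nat \<Rightarrow> nat \<Rightarrow> nat \<Rightarrow> nat \<Rightarrow> 'w \<Rightarrow> 'z"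
    and \<theta> :: "nat \<Rightarrow> nat \<Rightarrow> 'w \<Rightarrow> 'u"
    and N B :: nat and K s :: "nat \<Rightarrow> nat" and \<gamma> q :: "nat \<Rightarrow> real"
    and L \<sigma> G fstar :: real and x1 :: "real ^ 'd"
  defines "f \<equiv> local_loss M F \<zeta>"
  defines "f_glob \<equiv> global_loss M F \<zeta> N"
  defines "x_bar \<equiv> (\<lambda>k0 k \<omega>. mean_model F Q N K B s \<gamma> x1
                         (\<lambda>n i j b. \<xi> n i j b \<omega>) (\<lambda>i n. \<theta> i n \<omega>) k0 k)"
  assumes prob_M: "prob_space M"
    and N_pos: "N \<ge> 1"
    and B_pos: "B \<ge> 1"
    and K_pos: "\<And>n. n \<in> {0..N} \<Longrightarrow> K n \<ge> 1"
    and s_pos: "\<And>n. n \<in> {0..N} \<Longrightarrow> s n \<ge> 1"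
    and zeta_measurable: "\<And>n. n \<in> {1..N} \<Longrightarrow> \<zeta> n \<in> measurable M Z"
    and F_measurable: "\<And>x. F x \<in> borel_measurable Z"
    and F_differentiable: "\<And>x z. z \<in> space Z \<Longrightarrow> (\<lambda>y. F y z) differentiable (at x)"
    and F_integrable: "\<And>n x. n \<in> {1..N} \<Longrightarrow> integrable M (\<lambda>\<omega>. F x (\<zeta> n \<omega>))"
    and grad_F_integrable: "\<And>n x. n \<in> {1..N} \<Longrightarrow> integrable M (\<lambda>\<omega>. grad (\<lambda>y. F y (\<zeta> n \<omega>)) x)"
    and grad_F_unbiased: "\<And>n x. n \<in> {1..N} \<Longrightarrow> (\<integral>\<omega>. grad (\<lambda>y. F y (\<zeta> n \<omega>)) x \<partial>M) = grad (f n) x"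
    and fstar_attained: "\<exists>xs. f_glob xs = fstar"
    and fstar_le: "\<And>x. fstar \<le> f_glob x"
    and sample_measurable: "\<And>n k0 k b. Sample n k0 k b \<in> draws N K B \<Longrightarrow> \<xi> n k0 k b \<in> measurable M Z"
    and sample_distr: "\<And>n k0 k b. Sample n k0 k b \<in> draws N K B
           \<Longrightarrow> distr M Z (\<xi> n k0 k b) = distr M Z (\<zeta> n)"
    and seed_measurable: "\<And>k0 n. Seed k0 n \<in> draws N K B \<Longrightarrow> \<theta> k0 n \<in> measurable M (U (s n))"
    and seed_distr: "\<And>k0 n. Seed k0 n \<in> draws N K B \<Longrightarrow> distr M (U (s n)) (\<theta> k0 n) = U (s n)"
    and independent_draws: "prob_space.indep_sets M (draw_events M Z U s \<xi> \<theta>) (draws N K B)"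
    and quant_prob: "\<And>t. t \<ge> 1 \<Longrightarrow> prob_space (U t)"
    and quant_measurable: "\<And>t. t \<ge> 1 \<Longrightarrow> (\<lambda>(u, y). Q t u y) \<in> borel_measurable (U t \<Otimes>\<^sub>M borel)"
    and q_pos: "\<And>t. t \<ge> 1 \<Longrightarrow> q t > 0"
    and quant_integrable: "\<And>t y. t \<ge> 1 \<Longrightarrow> integrable (U t) (\<lambda>u. Q t u y)"
    and quant_unbiased: "\<And>t y. t \<ge> 1 \<Longrightarrow> (\<integral>u. Q t u y \<partial>U t) = y"
    and quant_error_integrable: "\<And>t y. t \<ge> 1 \<Longrightarrow> integrable (U t) (\<lambda>u. (norm (Q t u y - y))\<^sup>2)"
    and quant_error: "\<And>t y. t \<ge> 1 \<Longrightarrow> (\<integral>u. (norm (Q t u y - y))\<^sup>2 \<partial>U t) \<le> q t * (norm y)\<^sup>2"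
    and data_indep: "prob_space.indep_vars M (\<lambda>_. Z) \<zeta> {1..N}"
    and data_identical: "\<And>n m. n \<in> {1..N} \<Longrightarrow> m \<in> {1..N} \<Longrightarrow> distr M Z (\<zeta> n) = distr M Z (\<zeta> m)"
    and L_pos: "L > 0"
    and smooth_differentiable: "\<And>n x. n \<in> {1..N} \<Longrightarrow> f n differentiable (at x)"
    and smooth_grad_continuous: "\<And>n. n \<in> {1..N} \<Longrightarrow> continuous_on UNIV (grad (f n))"
    and smooth_Lipschitz: "\<And>n x y. n \<in> {1..N} \<Longrightarrow>
           norm (grad (f n) x - grad (f n) y) \<le> L * norm (x - y)"
    and sigma_pos: "\<sigma> > 0"
    and variance_integrable: "\<And>n x. n \<in> {1..N} \<Longrightarrow>
           integrable M (\<lambda>\<omega>. (norm (grad (\<lambda>y. F y (\<zeta> n \<omega>)) x - grad (f n) x))\<^sup>2)"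
    and variance_bound: "\<And>n x. n \<in> {1..N} \<Longrightarrow>
           (\<integral>\<omega>. (norm (grad (\<lambda>y. F y (\<zeta> n \<omega>)) x - grad (f n) x))\<^sup>2 \<partial>M) \<le> \<sigma>\<^sup>2"
    and G_pos: "G > 0"
    and second_moment_integrable: "\<And>n x. n \<in> {1..N} \<Longrightarrow>
           integrable M (\<lambda>\<omega>. (norm (grad (\<lambda>y. F y (\<zeta> n \<omega>)) x))\<^sup>2)"
    and second_moment_bound: "\<And>n x. n \<in> {1..N} \<Longrightarrow>
           (\<integral>\<omega>. (norm (grad (\<lambda>y. F y (\<zeta> n \<omega>)) x))\<^sup>2 \<partial>M) \<le> G\<^sup>2"
    and step_size: "\<And>k0. k0 \<in> {1..K 0} \<Longrightarrow> \<gamma> k0 \<in> {0<..1 / L}"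
  shows "(\<forall>k0\<in>{1..K 0}. \<forall>k\<in>{1..Kmax N K}.
            integrable M (\<lambda>\<omega>. (norm (grad f_glob (x_bar k0 (k - 1) \<omega>)))\<^sup>2))
         \<and> (\<Sum>k0=1..K 0. \<gamma> k0 * (\<Sum>k=1..Kmax N K. real (active_workers N K k) / real N *
               (\<integral>\<omega>. (norm (grad f_glob (x_bar k0 (k - 1) \<omega>)))\<^sup>2 \<partial>M)))
           / (\<Sum>k0=1..K 0. \<gamma> k0 * (\<Sum>k=1..Kmax N K. real (active_workers N K k) / real N))
           \<le> C_A N K B \<gamma> s q L \<sigma> G (f_glob x1) fstar"
proof -
  interpret prob_space M
    by (rule prob_M)
  have one: "1 \<in> {1..N}"
    using N_pos by simp
  \<comment> \<open>A local loss depends on its worker only through the law of \<zeta>_n, and these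
    laws coincide.\<close>
  have same: "f n x = f 1 x" if "n \<in> {1..N}" for n x
  proof -
    have "f n x = (\<integral>z. F x z \<partial>distr M Z (\<zeta> n))" if "n \<in> {1..N}" for n
      unfolding f_def local_loss_def
      using zeta_measurable[OF that] F_measurable by (simp add: integral_distr)
    then show ?thesis
      using that one data_identical[OF that one] by simp
  qed
  have f_glob: "f_glob = f 1"
  proof
    fix x
    have "f_glob x = (1 / real N) * (\<Sum>n=1..N. f n x)"
      by (simp add: f_glob_def f_def global_loss_def)
    also have "(\<Sum>n=1..N. f n x) = (\<Sum>n=1..N. f 1 x)"
      by (rule sum.cong[OF refl]) (rule same)
    finally show "f_glob x = f 1 x"
      using N_pos by simp
  qed
  have f_eq: "f n = f_glob" if "n \<in> {1..N}" for n
    unfolding f_glob by (rule ext) (rule same[OF that])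
  define H where "H = (\<lambda>x z. grad (\<lambda>y. F y z) x)"
  have H_pair: "(\<lambda>(x, z). H x z) \<in> borel_measurable (borel \<Otimes>\<^sub>M Z)"
    unfolding H_def using F_measurable F_differentiable by (rule borel_measurable_pair_grad)
  have H_meas: "H x \<in> borel_measurable Z" for x
    using measurable_compose[OF measurable_Pair1' H_pair, of x] by simp
  have sample: "n \<in> {1..N} \<and> distr M Z (\<xi> n k0 k b) = distr M Z (\<zeta> n)"
    if "Sample n k0 k b \<in> draws N K B" for n k0 k b
    using that sample_distr[OF that] by (auto simp: draws_def)
  \<comment> \<open>Change of variables: hypotheses about \<zeta>_n become statements about its law,
    which is also the law of each sample of worker n.\<close>
  have integrable_zeta: "integrable (distr M Z (\<zeta> n)) h \<longleftrightarrow> integrable M (\<lambda>\<omega>. h (\<zeta> n \<omega>))"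
    and integral_zeta: "(\<integral>z. h z \<partial>distr M Z (\<zeta> n)) = (\<integral>\<omega>. h (\<zeta> n \<omega>) \<partial>M)"
    if "n \<in> {1..N}" "h \<in> borel_measurable Z" for n and h :: "'z \<Rightarrow> 'c::euclidean_space"
    using zeta_measurable[OF that(1)] that(2) by (auto simp: integrable_distr_eq integral_distr)
  interpret genqsgd M Z U F Q \<xi> \<theta> N B K s \<gamma> q L \<sigma> G fstar x1 f_glob "grad f_glob"
  proof (rule genqsgd.intro[OF prob_M], rule genqsgd_axioms.intro)
    show "GDERIV f_glob x :> grad f_glob x" for x
      using smooth_differentiable[OF one, of x]
      by (intro differentiable_imp_GDERIV_grad) (simp add: f_glob)
    show "norm (grad f_glob x - grad f_glob y) \<le> L * norm (x - y)" for x y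
      using smooth_Lipschitz[OF one] by (simp add: f_glob)
    show "(\<lambda>(x, z). grad (\<lambda>y. F y z) x) \<in> borel_measurable (borel \<Otimes>\<^sub>M Z)"
      using H_pair by (simp add: H_def)
    fix n k0 k b and x :: "real ^ 'd"
    assume "Sample n k0 k b \<in> draws N K B"
    then have n: "n \<in> {1..N}" and d: "distr M Z (\<xi> n k0 k b) = distr M Z (\<zeta> n)"
      using sample by auto
    have m: "H x \<in> borel_measurable Z" "(\<lambda>z. (norm (H x z - grad f_glob x))\<^sup>2) \<in> borel_measurable Z"
      "(\<lambda>z. (norm (H x z))\<^sup>2) \<in> borel_measurable Z"
      using H_meas[of x] by measurable
    show "integrable (distr M Z (\<xi> n k0 k b)) (\<lambda>z. grad (\<lambda>y. F y z) x)"
      unfolding d using integrable_zeta[OF n m(1)] grad_F_integrable[OF n] by (simp add: H_def)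
    show "(\<integral>z. grad (\<lambda>y. F y z) x \<partial>distr M Z (\<xi> n k0 k b)) = grad f_glob x"
      unfolding d using integral_zeta[OF n m(1)] grad_F_unbiased[OF n] by (simp add: H_def f_eq[OF n])
    show "integrable (distr M Z (\<xi> n k0 k b)) (\<lambda>z. (norm (grad (\<lambda>y. F y z) x - grad f_glob x))\<^sup>2)"
      unfolding d using integrable_zeta[OF n m(2)] variance_integrable[OF n, of x]
      by (simp add: H_def f_eq[OF n])
    show "(\<integral>z. (norm (grad (\<lambda>y. F y z) x - grad f_glob x))\<^sup>2 \<partial>distr M Z (\<xi> n k0 k b)) \<le> \<sigma>\<^sup>2"
      unfolding d using integral_zeta[OF n m(2)] variance_bound[OF n, of x]
      by (simp add: H_def f_eq[OF n])
    show "integrable (distr M Z (\<xi> n k0 k b)) (\<lambda>z. (norm (grad (\<lambda>y. F y z) x))\<^sup>2)"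
      unfolding d using integrable_zeta[OF n m(3)] second_moment_integrable[OF n, of x]
      by (simp add: H_def)
    show "(\<integral>z. (norm (grad (\<lambda>y. F y z) x))\<^sup>2 \<partial>distr M Z (\<xi> n k0 k b)) \<le> G\<^sup>2"
      unfolding d using integral_zeta[OF n m(3)] second_moment_bound[OF n, of x]
      by (simp add: H_def)
  qed (fact N_pos B_pos s_pos sample_measurable seed_measurable seed_distr independent_draws
      quant_measurable q_pos quant_prob quant_integrable quant_unbiased quant_error_integrable
      quant_error L_pos step_size fstar_le)+
  have x_bar: "x_bar k0 k \<omega> = V k0 k \<omega>" for k0 k \<omega>
    by (simp add: x_bar_def V_def)
  show ?thesis
    using integrable_gradient_norm2 average_gradient_bound[OF K_pos]
    unfolding x_bar round_gradients_def by blast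
qed

end
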